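(* Let $\mu$ be an $n$-dimensional complex associative algebra on $\mathbb C^n$. Then the functional $F_n:\mathcal A_n\to\mathbb R$ attains its minimum value (over $\mathcal A_n$) at some point $[\lambda]\in\mathrm{GL}(n).[\mu]$ if and only if $\mu$ is semisimple. In this case $F_n([\lambda])=\frac4n$.
   Context: $V_n$ is the space of bilinear maps $\mu:\mathbb C^n\times\mathbb C^n\to\mathbb C^n$ with $\mathrm{GL}(n)$-action $g.\mu(X,Y)=g\mu(g^{-1}X,g^{-1}Y)$ and standard Hermitian structures. $\mathcal A_n\subset\mathbb PV_n$ is the projectivization of the algebraic set of associative $\mu\in V_n$. $L^\mu_XY=\mu(X,Y)$, $R^\mu_XY=\mu(Y,X)$, $\mathrm M_\mu=2\sum_i L^\mu_{X_i}(L^\mu_{X_i})^*-2\sum_i (L^\mu_{X_i})^*L^\mu_{X_i}-2\sum_i (R^\mu_{X_i})^*R^\mu_{X_i}$ ($\{X_i\}$ orthonormal), $\|\mu\|^2=\sum_{i,j}\|\mu(X_i,X_j)\|^2$, $F_n([\mu])=\operatorname{tr}\mathrm M_\mu^2/\|\mu\|^4$. An associative algebra is semisimple if its radical (largest nilpotent ideal) is zero. *)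

theory Defs
  imports "HOL-Analysis.Analysis"
begin

text \<open>Elements of V_n: complex bilinear maps on complex^'n, n = CARD('n).\<close>

type_synonym 'n alg = "complex^'n \<Rightarrow> complex^'n \<Rightarrow> complex^'n"

definition cbilinear :: "'n::finite alg \<Rightarrow> bool" where
  "cbilinear \<mu> \<longleftrightarrow>
     (\<forall>x. Vector_Spaces.linear (*s) (*s) (\<mu> x)) \<and>
     (\<forall>y. Vector_Spaces.linear (*s) (*s) (\<lambda>x. \<mu> x y))"

definition assoc_alg :: "'n::finite alg \<Rightarrow> bool" where
  "assoc_alg \<mu> \<longleftrightarrow> (\<forall>x y z. \<mu> (\<mu> x y) z = \<mu> x (\<mu> y z))"

text \<open>GL(n)-action: (g.mu)(X,Y) = g mu(g^-1 X, g^-1 Y).\<close>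
definition gl_act :: "complex^'n^'n \<Rightarrow> 'n::finite alg \<Rightarrow> 'n alg" where
  "gl_act g \<mu> = (\<lambda>X Y. g *v \<mu> (matrix_inv g *v X) (matrix_inv g *v Y))"

text \<open>Matrices of L_X and R_X, conjugate transpose (adjoint w.r.t. the standard Hermitian product).\<close>
definition Lmat :: "'n::finite alg \<Rightarrow> complex^'n \<Rightarrow> complex^'n^'n" where
  "Lmat \<mu> X = (\<chi> k j. \<mu> X (axis j 1) $ k)"

definition Rmat :: "'n::finite alg \<Rightarrow> complex^'n \<Rightarrow> complex^'n^'n" where
  "Rmat \<mu> X = (\<chi> k j. \<mu> (axis j 1) X $ k)"

definition adj :: "complex^'n^'n \<Rightarrow> complex^'n^'n" where
  "adj A = (\<chi> i j. cnj (A $ j $ i))"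

text \<open>M_mu computed with the standard orthonormal basis X_i = e_i.\<close>
definition Mmu :: "'n::finite alg \<Rightarrow> complex^'n^'n" where
  "Mmu \<mu> =
     2 *\<^sub>R (\<Sum>i\<in>UNIV. Lmat \<mu> (axis i 1) ** adj (Lmat \<mu> (axis i 1)))
   - 2 *\<^sub>R (\<Sum>i\<in>UNIV. adj (Lmat \<mu> (axis i 1)) ** Lmat \<mu> (axis i 1))
   - 2 *\<^sub>R (\<Sum>i\<in>UNIV. adj (Rmat \<mu> (axis i 1)) ** Rmat \<mu> (axis i 1))"

definition norm_sq_alg :: "'n::finite alg \<Rightarrow> real" where
  "norm_sq_alg \<mu> = (\<Sum>i\<in>UNIV. \<Sum>j\<in>UNIV. (norm (\<mu> (axis i 1) (axis j 1)))^2)"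

text \<open>F_n([mu]) = tr(M_mu^2)/||mu||^4 (tr M_mu^2 is real since M_mu is Hermitian); F is
  invariant under nonzero scaling, so it is well defined on the projective class.\<close>
definition Fn :: "'n::finite alg \<Rightarrow> real" where
  "Fn \<mu> = Re (trace (Mmu \<mu> ** Mmu \<mu>)) / (norm_sq_alg \<mu>)^2"

text \<open>Ideals, nilpotent ideals, semisimplicity.\<close>
definition csubspace :: "(complex^'n::finite) set \<Rightarrow> bool" where
  "csubspace I \<longleftrightarrow> 0 \<in> I \<and> (\<forall>x\<in>I. \<forall>y\<in>I. x + y \<in> I) \<and> (\<forall>c. \<forall>x\<in>I. c *s x \<in> I)"

definition alg_ideal :: "'n::finite alg \<Rightarrow> (complex^'n) set \<Rightarrow> bool" where
  "alg_ideal \<mu> I \<longleftrightarrow> csubspace I \<and> (\<forall>x\<in>I. \<forall>y. \<mu> x y \<in> I \<and> \<mu> y x \<in> I)"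

fun prodl :: "'n::finite alg \<Rightarrow> complex^'n \<Rightarrow> (complex^'n) list \<Rightarrow> complex^'n" where
  "prodl \<mu> x [] = x"
| "prodl \<mu> x (y # ys) = prodl \<mu> (\<mu> x y) ys"

text \<open>I is nilpotent: I^m = 0 for some m, i.e. all products of m+1 elements of I vanish.\<close>
definition nilpotent_ideal :: "'n::finite alg \<Rightarrow> (complex^'n) set \<Rightarrow> bool" where
  "nilpotent_ideal \<mu> I \<longleftrightarrow> alg_ideal \<mu> I \<and>
     (\<exists>m. \<forall>x\<in>I. \<forall>ys. length ys = m \<and> set ys \<subseteq> I \<longrightarrow> prodl \<mu> x ys = 0)"

text \<open>Semisimple: the radical (largest nilpotent ideal) is zero, i.e. every nilpotent ideal is
  contained in the zero ideal.\<close>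
definition semisimple :: "'n::finite alg \<Rightarrow> bool" where
  "semisimple \<mu> \<longleftrightarrow> (\<forall>I. nilpotent_ideal \<mu> I \<longrightarrow> I \<subseteq> {0})"

text \<open>[lam] minimizes F_n over A_n (nonzero associative bilinear maps up to scaling).\<close>
definition is_min_An :: "'n::finite alg \<Rightarrow> bool" where
  "is_min_An lam \<longleftrightarrow> (\<forall>\<nu>::'n alg. cbilinear \<nu> \<and> assoc_alg \<nu> \<and> \<nu> \<noteq> (\<lambda>X Y. 0) \<longrightarrow> Fn lam \<le> Fn \<nu>)"

end

theory Submission
  imports Defs "HOL-Computational_Algebra.Fundamental_Theorem_Algebra"
begin

text \<open>Since M is Hermitian with trace -2 |mu|^2, the Cauchy-Schwarz inequality gives F >= 4/n with
  equality iff M = c I for c = -2 |mu|^2 / n, and the algebra of diagonal matrices attains 4/n.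

  If M = c I and J is an ideal with J.J = 0, then pairing M with the orthogonal projection P onto J gives
  tr (M P) = c dim J <= 0, while writing tr (M P) through the components of mu with respect to J and its
  orthogonal complement gives tr (M P) >= 0, because the only negative contribution comes from J.J. Hence
  J = 0, and an algebra without nonzero ideals of square zero is semisimple.

  Conversely, a semisimple algebra is spanned by matrix units. Declaring E_ij / sqrt d orthonormal, where d
  is the size of the block of E_ij, turns each of the three sums in M into 2 I, so that M = -2 I.\<close>

section \<open>The moment map and the lower bound for F\<close>

text \<open>No variational theory of F enters: the bound 4/n is explicit and attained in every
  dimension, so being a minimizer becomes the equation M = c I for the single algebra g.mu. Most of
  the work lies in producing matrix units, since mu is not assumed to have a unit. Minimal right
  ideals supply primitive idempotents e, and a maximal orthogonal family of these sums to a unit.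
  Algebraic closedness of the complex numbers enters through an eigenvector, which makes each corner
  e.A.e one-dimensional. The factor 1 / sqrt d is forced: in the basis t E_ij the structure
  constants are 0 or t, and each diagonal entry of the sums of L L^*, L^* L and R^* R collects d
  terms t^2, so t^2 = 1/d turns all three into the identity.\<close>

definition frob_sq :: "complex^'n^'n::finite \<Rightarrow> real" where
  "frob_sq A = (\<Sum>j\<in>UNIV. (norm (A *v axis j 1))\<^sup>2)"

lemma norm_vec_sq: "(norm (x::complex^'n::finite))\<^sup>2 = (\<Sum>i\<in>UNIV. (norm (x $ i))\<^sup>2)"
  by (simp add: norm_vec_def L2_set_def sum_nonneg)

lemma mult_axis_component: "((A::complex^'n^'m) *v axis j 1) $ k = A $ k $ j"
  by (simp add: matrix_vector_mult_def axis_def if_distrib cong: if_cong)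

lemma matrix_add_rdistrib: "(A + B) ** C = A ** C + B ** (C::complex^'n^'n)"
  by (simp add: matrix_matrix_mult_def vec_eq_iff distrib_right sum.distrib)

lemma matrix_diff_rdistrib: "(A - B) ** C = A ** C - B ** (C::complex^'n^'n)"
  by (simp add: matrix_matrix_mult_def vec_eq_iff left_diff_distrib sum_subtractf)

lemma matrix_diff_ldistrib: "A ** (B - C) = A ** B - A ** (C::complex^'n^'n)"
  by (simp add: matrix_matrix_mult_def vec_eq_iff right_diff_distrib sum_subtractf)

lemma adj_adj [simp]: "adj (adj A) = A"
  by (simp add: adj_def vec_eq_iff)

lemma adj_mult: "adj (A ** B) = adj B ** adj A"
  by (simp add: adj_def matrix_matrix_mult_def vec_eq_iff mult.commute)

lemma adj_diff: "adj (A - B) = adj A - adj B"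
  by (simp add: adj_def vec_eq_iff)

lemma adj_scaleR: "adj (r *\<^sub>R A) = r *\<^sub>R adj A"
  by (simp add: adj_def vec_eq_iff)

lemma adj_sum: "adj (\<Sum>i\<in>S. f i) = (\<Sum>i\<in>S. adj (f i))"
  by (simp add: adj_def vec_eq_iff)

lemma adj_mat1 [simp]: "adj (mat 1) = mat 1"
  by (simp add: adj_def mat_def vec_eq_iff)

text \<open>Both sides sum the squared absolute values of the entries. \<open>frob_sq\<close> goes
  by columns because column j of \<open>Lmat \<mu> x\<close> is the product of x with the j-th basis
  vector.\<close>

lemma trace_mult_adj: "trace (A ** adj A) = of_real (frob_sq A)"
proof -
  have "trace (A ** adj A) = (\<Sum>i\<in>UNIV. \<Sum>k\<in>UNIV. of_real ((norm (A $ i $ k))\<^sup>2))"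
    by (simp add: trace_def matrix_matrix_mult_def adj_def flip: complex_norm_square)
  also have "\<dots> = (\<Sum>k\<in>UNIV. \<Sum>i\<in>UNIV. of_real ((norm (A $ i $ k))\<^sup>2))"
    by (rule sum.swap)
  also have "\<dots> = of_real (frob_sq A)"
    by (simp add: frob_sq_def norm_vec_sq mult_axis_component)
  finally show ?thesis .
qed

lemma frob_sq_nonneg: "frob_sq A \<ge> 0"
  by (simp add: frob_sq_def sum_nonneg)

lemma frob_sq_eq_0_iff: "frob_sq A = 0 \<longleftrightarrow> A = 0"
proof
  assume "frob_sq A = 0"
  then have "\<forall>j. A *v axis j 1 = 0"
    by (simp add: frob_sq_def sum_nonneg_eq_0_iff)
  then show "A = 0"
    by (metis (no_types) mult_axis_component vec_eq_iff zero_index)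
qed (simp add: frob_sq_def)

lemma trace_scaleR: "trace (r *\<^sub>R A) = r *\<^sub>R trace (A::complex^'n^'n)"
  by (simp add: trace_def scaleR_sum_right)

lemma trace_scaleR_mult: "trace ((r *\<^sub>R A) ** B) = of_real r * trace (A ** (B::complex^'n^'n))"
  by (simp add: trace_def matrix_matrix_mult_def scaleR_conv_of_real[where 'a=complex] sum_distrib_left mult.assoc)

lemma trace_sum: "trace (\<Sum>i\<in>S. f i) = (\<Sum>i\<in>S. trace (f i :: complex^'n^'n))"
  unfolding trace_def by (simp add: sum.swap[of _ S])

lemma sum_matrix_mult: "(\<Sum>i\<in>S. f i) ** (P::complex^'n^'n) = (\<Sum>i\<in>S. f i ** P)"
  by (induction S rule: infinite_finite_induct) (auto simp: matrix_add_rdistrib)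

lemma adj_Mmu: "adj (Mmu \<mu>) = Mmu \<mu>"
  by (simp add: Mmu_def adj_diff adj_scaleR adj_sum adj_mult)

text \<open>For an orthogonal projection, P = P^2 = P^* and cyclicity of the trace turn each summand
  of tr (M P) into a squared norm. P = \<open>mat 1\<close> yields the trace of M; the projection
  onto an ideal yields the obstruction to M = c I.\<close>

lemma trace_Mmu_mult:
  assumes P: "P ** P = P" "adj P = P"
  shows "trace (Mmu \<mu> ** P) = of_real
    (2 * (\<Sum>i\<in>UNIV. frob_sq (P ** Lmat \<mu> (axis i 1)))
     - 2 * (\<Sum>i\<in>UNIV. frob_sq (Lmat \<mu> (axis i 1) ** P))
     - 2 * (\<Sum>i\<in>UNIV. frob_sq (Rmat \<mu> (axis i 1) ** P)))"
proof -
  have 1: "trace (A ** adj A ** P) = of_real (frob_sq (P ** A))" for A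
  proof -
    have "trace (A ** adj A ** P) = trace ((A ** adj A ** P) ** P)"
      using P by (simp flip: matrix_mul_assoc)
    also have "\<dots> = trace (P ** (A ** adj A ** P))"
      by (rule trace_mul_sym)
    also have "\<dots> = trace ((P ** A) ** adj (P ** A))"
      using P by (simp add: adj_mult matrix_mul_assoc)
    finally show ?thesis by (simp add: trace_mult_adj)
  qed
  have 2: "trace (adj A ** A ** P) = of_real (frob_sq (A ** P))" for A
  proof -
    have "trace (adj A ** A ** P) = trace (A ** P ** P ** adj A)"
      using P trace_mul_sym[of "adj A" "A ** P"] by (simp flip: matrix_mul_assoc)
    also have "\<dots> = trace ((A ** P) ** adj (A ** P))"
      using P by (simp add: adj_mult matrix_mul_assoc)
    finally show ?thesis by (simp add: trace_mult_adj)
  qed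
  show ?thesis
    unfolding Mmu_def
    by (simp add: matrix_diff_rdistrib trace_sub sum_matrix_mult trace_sum trace_scaleR_mult 1 2)
qed

lemma Lmat_axis: "Lmat \<mu> x *v axis j 1 = \<mu> x (axis j 1)"
  by (simp add: Lmat_def vec_eq_iff mult_axis_component)

lemma Rmat_axis: "Rmat \<mu> x *v axis j 1 = \<mu> (axis j 1) x"
  by (simp add: Rmat_def vec_eq_iff mult_axis_component)

lemma trace_Mmu: "trace (Mmu \<mu>) = of_real (- 2 * norm_sq_alg \<mu>)"
proof -
  have "(\<Sum>i\<in>UNIV. frob_sq (Lmat \<mu> (axis i 1))) = norm_sq_alg \<mu>"
    by (simp add: frob_sq_def norm_sq_alg_def Lmat_axis)
  moreover have "(\<Sum>i\<in>UNIV. frob_sq (Rmat \<mu> (axis i 1))) = norm_sq_alg \<mu>"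
    unfolding frob_sq_def norm_sq_alg_def Rmat_axis by (rule sum.swap)
  ultimately show ?thesis
    using trace_Mmu_mult[of "mat 1" \<mu>] by simp
qed

text \<open>Here c is the trace of M divided by n, so c I is the component of M along the scalar
  matrices. This Pythagorean identity contains both the Cauchy-Schwarz bound and its equality
  case.\<close>

lemma frob_sq_Mmu_diff:
  fixes \<mu> :: "'n::finite alg"
  defines "c \<equiv> - 2 * norm_sq_alg \<mu> / real CARD('n)"
  shows "frob_sq (Mmu \<mu> - c *\<^sub>R mat 1) =
    Re (trace (Mmu \<mu> ** Mmu \<mu>)) - 4 * (norm_sq_alg \<mu>)\<^sup>2 / real CARD('n)"
proof -
  let ?M = "Mmu \<mu>" and ?N = "Mmu \<mu> - c *\<^sub>R mat 1"
  have c: "c * real CARD('n) = - 2 * norm_sq_alg \<mu>"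
    by (simp add: c_def)
  have "?N ** ?N = ?M ** ?M - (2 * c) *\<^sub>R ?M + (c * c) *\<^sub>R mat 1"
    by (simp add: matrix_diff_rdistrib matrix_diff_ldistrib matrix_scalar_ac
        scaleR_diff_right flip: scalar_matrix_assoc)
      (simp add: vec_eq_iff scaleR_conv_of_real[where 'a=complex])
  then have "Re (trace (?N ** ?N)) = Re (trace (?M ** ?M)) + 4 * c * norm_sq_alg \<mu>
      + c * (c * real CARD('n))"
    by (simp add: trace_add trace_sub trace_scaleR trace_Mmu trace_I)
  also have "\<dots> = Re (trace (?M ** ?M)) - 4 * (norm_sq_alg \<mu>)\<^sup>2 / real CARD('n)"
    unfolding c by (simp add: c_def power2_eq_square)
  finally have "Re (trace (?N ** ?N)) = Re (trace (?M ** ?M))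
      - 4 * (norm_sq_alg \<mu>)\<^sup>2 / real CARD('n)" .
  moreover have "adj ?N = ?N"
    by (simp add: adj_diff adj_scaleR adj_Mmu)
  ultimately show ?thesis
    using trace_mult_adj[of ?N] by simp
qed

lemma Fn_ge:
  fixes \<mu> :: "'n::finite alg"
  assumes "norm_sq_alg \<mu> \<noteq> 0"
  shows "4 / real CARD('n) \<le> Fn \<mu>"
proof -
  have "0 \<le> Re (trace (Mmu \<mu> ** Mmu \<mu>)) - 4 * (norm_sq_alg \<mu>)\<^sup>2 / real CARD('n)"
    unfolding frob_sq_Mmu_diff[symmetric] by (rule frob_sq_nonneg)
  then show ?thesis
    using assms by (simp add: Fn_def field_simps)
qed

lemma Fn_eq_iff:
  fixes \<mu> :: "'n::finite alg"
  assumes "norm_sq_alg \<mu> \<noteq> 0"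
  shows "Fn \<mu> = 4 / real CARD('n) \<longleftrightarrow>
    Mmu \<mu> = (- 2 * norm_sq_alg \<mu> / real CARD('n)) *\<^sub>R mat 1"
proof -
  have "Fn \<mu> = 4 / real CARD('n) \<longleftrightarrow>
      Re (trace (Mmu \<mu> ** Mmu \<mu>)) - 4 * (norm_sq_alg \<mu>)\<^sup>2 / real CARD('n) = 0"
    using assms by (simp add: Fn_def field_simps)
  also have "\<dots> \<longleftrightarrow> Mmu \<mu> - (- 2 * norm_sq_alg \<mu> / real CARD('n)) *\<^sub>R mat 1 = 0"
    unfolding frob_sq_Mmu_diff[symmetric] frob_sq_eq_0_iff ..
  finally show ?thesis by (simp only: right_minus_eq)
qed

lemma norm_sq_alg_eq_0_iff:
  assumes "cbilinear \<mu>"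
  shows "norm_sq_alg \<mu> = 0 \<longleftrightarrow> \<mu> = (\<lambda>X Y. 0)"
proof
  assume "norm_sq_alg \<mu> = 0"
  then have 0: "\<mu> (axis i 1) (axis j 1) = 0" for i j
    by (simp add: norm_sq_alg_def sum_nonneg_eq_0_iff sum_nonneg)
  have lin: "Vector_Spaces.linear (*s) (*s) (\<mu> x)" "Vector_Spaces.linear (*s) (*s) (\<lambda>x. \<mu> x y)" for x y
    using assms by (auto simp: cbilinear_def)
  have "Lmat \<mu> (axis i 1) = 0" for i
    by (simp add: Lmat_def 0 vec_eq_iff)
  then have "\<mu> (axis i 1) y = 0" for i y
    using matrix_works[OF lin(1), of "axis i 1" y] by (simp add: Lmat_def matrix_def)
  then have "Rmat \<mu> y = 0" for y
    by (simp add: Rmat_def vec_eq_iff)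
  then have "\<mu> x y = 0" for x y
    using matrix_works[OF lin(2), of y x] by (simp add: Rmat_def matrix_def)
  then show "\<mu> = (\<lambda>X Y. 0)" by blast
qed (simp add: norm_sq_alg_def)

section \<open>Ideals of square zero at critical points\<close>

text \<open>The inner product at hand is the real part of the Hermitian one. Since J is closed under
  complex scalars, real orthogonality to J is Hermitian orthogonality, so the real projection is
  complex linear and self-adjoint.\<close>

lemma orthogonal_projection_matrix:
  fixes J :: "(complex^'n::finite) set"
  assumes J: "vec.subspace J"
  obtains P :: "complex^'n^'n" where "P ** P = P" "adj P = P"
    "\<And>x. P *v x \<in> J" "\<And>x. x \<in> J \<Longrightarrow> P *v x = x"
proof -
  have scaleR_eq: "r *\<^sub>R x = complex_of_real r *s x" for r and x :: "complex^'n"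
    by (simp add: vec_eq_iff scaleR_conv_of_real[where 'a=complex])
  have sub: "subspace J"
    using J unfolding subspace_def scaleR_eq by (auto simp: vec.subspace_def)
  have "\<exists>y\<in>J. \<forall>w\<in>J. (x - y) \<bullet> w = 0" for x
  proof -
    obtain y z where "y \<in> span J" "\<And>w. w \<in> span J \<Longrightarrow> orthogonal z w" "x = y + z"
      using orthogonal_subspace_decomp_exists[of J x] by metis
    then show ?thesis
      using sub by (intro bexI[of _ y]) (auto simp: orthogonal_def span_eq_iff[THEN iffD2])
  qed
  then obtain p where p: "\<And>x. p x \<in> J" "\<And>x w. w \<in> J \<Longrightarrow> (x - p x) \<bullet> w = 0"
    by metis
  \<comment> \<open>Uniqueness reduces linearity to checking that the expected value lies in J and
    leaves an orthogonal remainder.\<close>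
  have uniq: "p x = y" if "y \<in> J" "\<And>w. w \<in> J \<Longrightarrow> (x - y) \<bullet> w = 0" for x y
  proof -
    have "y - p x \<in> J"
      using that p sub by (simp add: subspace_diff)
    then have "(y - p x) \<bullet> (y - p x) = (x - p x) \<bullet> (y - p x) - (x - y) \<bullet> (y - p x)"
      by (simp add: inner_diff_left)
    also have "\<dots> = 0"
      using that p \<open>y - p x \<in> J\<close> by simp
    finally show ?thesis by simp
  qed
  have inner_smult: "(c *s z) \<bullet> w = z \<bullet> (cnj c *s w)" for c and z w :: "complex^'n"
    by (simp add: inner_vec_def inner_complex_def algebra_simps)
  have lin: "Vector_Spaces.linear (*s) (*s) p"
  unfolding Vector_Spaces.linear_iff
  proof (intro conjI allI vec.vector_space_axioms)
    show "p (x + y) = p x + p y" for x y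
    proof (rule uniq)
      show "p x + p y \<in> J" using p sub by (simp add: subspace_add)
      show "(x + y - (p x + p y)) \<bullet> w = 0" if "w \<in> J" for w
        using p(2)[OF that, of x] p(2)[OF that, of y] by (simp add: algebra_simps)
    qed
    show "p (c *s x) = c *s p x" for c x
    proof (rule uniq)
      show "c *s p x \<in> J" using p J by (simp add: vec.subspace_scale)
      show "(c *s x - c *s p x) \<bullet> w = 0" if "w \<in> J" for w
      proof -
        have "(c *s x - c *s p x) \<bullet> w = (x - p x) \<bullet> (cnj c *s w)"
          by (simp only: inner_smult vec.scale_right_diff_distrib[symmetric])
        also have "\<dots> = 0"
          using that J by (intro p vec.subspace_scale)
        finally show ?thesis .
      qed
    qed
  qed
  define P where "P = matrix p"
  have P: "P *v x = p x" for x
    unfolding P_def by (rule matrix_works[OF lin])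
  have id: "p x = x" if "x \<in> J" for x
    using that by (intro uniq) auto
  have "P ** P = P"
    by (simp add: matrix_eq P id p flip: matrix_vector_mul_assoc)
  moreover have "adj P = P"
  proof -
    have sym: "p x \<bullet> y = x \<bullet> p y" for x y
      using p(2)[OF p(1)[of x], of y] p(2)[OF p(1)[of y], of x]
      by (simp add: inner_diff_left inner_diff_right inner_commute)
    have "cnj (P $ j $ i) = P $ i $ j" for i j
    proof (rule complex_eqI)
      show "Re (cnj (P $ j $ i)) = Re (P $ i $ j)"
        using sym[of "axis j 1" "axis i 1"]
        by (simp add: inner_axis inner_axis' flip: P) (simp add: mult_axis_component inner_complex_def)
      \<comment> \<open>Symmetry for the real inner product compares only real parts; testing
        against an imaginary multiple of a basis vector recovers the imaginary parts.\<close>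
      have "axis i \<i> = \<i> *s axis i 1"
        by (simp add: axis_def vec_eq_iff)
      then have "p (axis i \<i>) = \<i> *s p (axis i 1)"
        using vec.linear_scale[OF lin, of \<i> "axis i 1"] by (simp only:)
      then show "Im (cnj (P $ j $ i)) = Im (P $ i $ j)"
        using sym[of "axis j 1" "axis i \<i>"]
        by (simp add: inner_axis inner_axis' flip: P) (simp add: mult_axis_component inner_complex_def)
    qed
    then show ?thesis by (simp add: adj_def vec_eq_iff)
  qed
  ultimately show ?thesis
    using that P p id by metis
qed

lemma Lmat_mult: "cbilinear \<mu> \<Longrightarrow> Lmat \<mu> x *v y = \<mu> x y"
  using matrix_works[of "\<mu> x"] by (simp add: cbilinear_def Lmat_def matrix_def)

lemma Rmat_mult: "cbilinear \<mu> \<Longrightarrow> Rmat \<mu> x *v y = \<mu> y x"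
  using matrix_works[of "\<lambda>y. \<mu> y x"] by (simp add: cbilinear_def Rmat_def matrix_def)

text \<open>Pythagoras, from A A^* = A P A^* + A (1 - P) A^* and the trace.\<close>

lemma frob_sq_split:
  assumes "P ** P = P" "adj P = P"
  shows "frob_sq A = frob_sq (A ** P) + frob_sq (A ** (mat 1 - P))"
proof -
  have "A ** P ** adj (A ** P) = A ** P ** adj A"
    using assms by (simp add: adj_mult matrix_mul_assoc) (simp flip: matrix_mul_assoc)
  moreover have "A ** (mat 1 - P) ** adj (A ** (mat 1 - P)) = A ** adj A - A ** P ** adj A"
    using assms
    by (simp add: adj_mult adj_diff matrix_diff_ldistrib matrix_diff_rdistrib matrix_mul_assoc)
      (simp flip: matrix_mul_assoc)
  ultimately have "A ** adj A = A ** P ** adj (A ** P) + A ** (mat 1 - P) ** adj (A ** (mat 1 - P))"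
    by simp
  from arg_cong[OF this, of trace] show ?thesis
    by (simp only: trace_add trace_mult_adj of_real_add[symmetric] of_real_eq_iff)
qed

text \<open>Put Q = 1 - P. Left multiplications preserve J, so P L P = L P, and splitting P L by P
  and Q cancels the L P terms. It remains to bound the R P terms by the P L Q terms: as J.J = 0, the
  former only see products in J.A whose right factor is in the complement of J, and these reappear
  among the latter.\<close>

lemma frob_sq_square_zero_ideal:
  fixes \<mu> :: "'n::finite alg"
  assumes bil: "cbilinear \<mu>" and J: "alg_ideal \<mu> J"
    and sq0: "\<And>x y. x \<in> J \<Longrightarrow> y \<in> J \<Longrightarrow> \<mu> x y = 0"
    and P: "P ** P = P" "adj P = P" "\<And>x. P *v x \<in> J" "\<And>x. x \<in> J \<Longrightarrow> P *v x = x"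
  shows "(\<Sum>i\<in>UNIV. frob_sq (Lmat \<mu> (axis i 1) ** P)) + (\<Sum>i\<in>UNIV. frob_sq (Rmat \<mu> (axis i 1) ** P))
    \<le> (\<Sum>i\<in>UNIV. frob_sq (P ** Lmat \<mu> (axis i 1)))"
proof -
  let ?L = "\<lambda>i. Lmat \<mu> (axis i 1)" and ?R = "\<lambda>i. Rmat \<mu> (axis i 1)" and ?Q = "mat 1 - P"
  have JI: "\<mu> x y \<in> J" "\<mu> y x \<in> J" if "x \<in> J" for x y
    using J that by (auto simp: alg_ideal_def)
  have lin: "Vector_Spaces.linear (*s) (*s) (\<mu> x)" for x
    using bil by (auto simp: cbilinear_def)
  have PL: "P ** ?L i ** P = ?L i ** P" for i
    by (simp add: matrix_eq Lmat_mult bil P JI flip: matrix_vector_mul_assoc)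
  have "(\<Sum>i\<in>UNIV. frob_sq (?R i ** P)) = (\<Sum>i\<in>UNIV. \<Sum>j\<in>UNIV. (norm (\<mu> (P *v axis j 1) (axis i 1)))\<^sup>2)"
    by (simp add: frob_sq_def Rmat_mult bil flip: matrix_vector_mul_assoc)
  \<comment> \<open>The inserted Q is harmless because J.J = 0, the inserted P because J is an
    ideal.\<close>
  also have "\<dots> = (\<Sum>i\<in>UNIV. frob_sq (P ** Rmat \<mu> (?Q *v axis i 1) ** P))"
  proof -
    have "\<mu> (P *v x) (?Q *v y) = \<mu> (P *v x) y" for x y
      by (simp add: matrix_vector_mult_diff_rdistrib vec.linear_diff[OF lin] sq0 P)
    then show ?thesis
      by (simp add: frob_sq_def Rmat_mult bil JI P flip: matrix_vector_mul_assoc)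
  qed
  also have "\<dots> \<le> (\<Sum>i\<in>UNIV. frob_sq (P ** Rmat \<mu> (?Q *v axis i 1)))"
  proof (rule sum_mono)
    show "frob_sq (A ** P) \<le> frob_sq A" for A
      using frob_sq_split[OF P(1,2), of A] frob_sq_nonneg[of "A ** (mat 1 - P)"] by linarith
  qed
  \<comment> \<open>Interchanging the summations regards the same products as left multiplications
    by the first factor.\<close>
  also have "\<dots> = (\<Sum>i\<in>UNIV. frob_sq (P ** ?L i ** ?Q))"
    unfolding frob_sq_def
    by (subst sum.swap) (simp add: Lmat_mult Rmat_mult bil flip: matrix_vector_mul_assoc)
  finally have "(\<Sum>i\<in>UNIV. frob_sq (?R i ** P)) \<le> (\<Sum>i\<in>UNIV. frob_sq (P ** ?L i ** ?Q))" .
  moreover have "(\<Sum>i\<in>UNIV. frob_sq (P ** ?L i)) =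
      (\<Sum>i\<in>UNIV. frob_sq (?L i ** P)) + (\<Sum>i\<in>UNIV. frob_sq (P ** ?L i ** ?Q))"
    using frob_sq_split[OF P(1,2), of "P ** ?L _"] by (simp only: PL sum.distrib)
  ultimately show ?thesis by simp
qed

lemma no_square_zero_ideal:
  fixes \<mu> :: "'n::finite alg"
  assumes bil: "cbilinear \<mu>" and M: "Mmu \<mu> = c *\<^sub>R mat 1" and "c < 0"
    and J: "alg_ideal \<mu> J" and sq0: "\<And>x y. x \<in> J \<Longrightarrow> y \<in> J \<Longrightarrow> \<mu> x y = 0"
  shows "J \<subseteq> {0}"
proof -
  have "vec.subspace J"
    using J by (auto simp: alg_ideal_def csubspace_def vec.subspace_def)
  then obtain P where P: "P ** P = P" "adj P = P" "\<And>x. P *v x \<in> J" "\<And>x. x \<in> J \<Longrightarrow> P *v x = x"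
    using orthogonal_projection_matrix[of J] by metis
  have "complex_of_real (c * frob_sq P) = trace (Mmu \<mu> ** P)"
    using trace_mult_adj[of P] P by (simp add: M trace_scaleR_mult)
  then have "c * frob_sq P = 2 * (\<Sum>i\<in>UNIV. frob_sq (P ** Lmat \<mu> (axis i 1)))
     - 2 * (\<Sum>i\<in>UNIV. frob_sq (Lmat \<mu> (axis i 1) ** P))
     - 2 * (\<Sum>i\<in>UNIV. frob_sq (Rmat \<mu> (axis i 1) ** P))"
    unfolding trace_Mmu_mult[OF P(1,2)] of_real_eq_iff .
  also have "\<dots> \<ge> 0"
    using frob_sq_square_zero_ideal[OF bil J sq0 P] by simp
  finally have "frob_sq P \<le> 0"
    using \<open>c < 0\<close> by (simp add: zero_le_mult_iff)
  then have "P = 0"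
    using frob_sq_nonneg[of P] frob_sq_eq_0_iff[of P] by simp
  then show ?thesis
    using P(4) by force
qed

section \<open>Eigenvectors in invariant subspaces\<close>

text \<open>More than n vectors of an n-dimensional space are dependent, so some iterate of f at t
  lies in the span of its predecessors; that relation is a monic polynomial.\<close>

lemma poly_annihilates_vector:
  fixes f :: "complex^'n::finite \<Rightarrow> complex^'n" and t :: "complex^'n"
  obtains p where "p \<noteq> 0" "(\<Sum>i\<le>degree p. coeff p i *s (f ^^ i) t) = 0"
proof -
  let ?g = "\<lambda>i. (f ^^ i) t"
  have "\<exists>i. ?g i \<in> vec.span (?g ` {..<i})"
  proof (rule ccontr)
    assume neg: "\<not> ?thesis"
    have "vec.independent (?g ` {..<i}) \<and> card (?g ` {..<i}) = i" for i
    proof (induction i)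
      case (Suc i)
      have "?g i \<notin> ?g ` {..<i}"
        using neg vec.span_base by metis
      then show ?case
        using Suc neg by (simp add: lessThan_Suc vec.independent_insert)
    qed (simp add: vec.independent_empty)
    then have "i \<le> CARD('n)" for i
      using vec.independent_card_le_dim[of "?g ` {..<i}" UNIV]
      by (simp add: vec.dim_UNIV card_cart_basis)
    then show False
      using not_less_eq_eq by blast
  qed
  then obtain i where i: "?g i \<in> vec.span (?g ` {..<i})" by blast
  \<comment> \<open>Combinations are indexed by exponents, not by vectors, so that they give
    polynomial coefficients even if iterates coincide.\<close>
  let ?W = "range (\<lambda>c. \<Sum>j<i. c j *s ?g j)"
  have "vec.subspace ?W"
    unfolding vec.subspace_def
  proof (intro conjI ballI allI)
    show "0 \<in> ?W" by (rule range_eqI[of _ _ "\<lambda>_. 0"]) simp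
    show "x + y \<in> ?W" if xy: "x \<in> ?W" "y \<in> ?W" for x y
    proof -
      obtain c where "x = (\<Sum>j<i. c j *s ?g j)"
        using xy(1) by (rule rangeE)
      moreover obtain d where "y = (\<Sum>j<i. d j *s ?g j)"
        using xy(2) by (rule rangeE)
      ultimately show ?thesis
        by (intro range_eqI[of _ _ "\<lambda>j. c j + d j"])
          (simp add: vec.scale_left_distrib sum.distrib)
    qed
    show "c *s x \<in> ?W" if x: "x \<in> ?W" for c x
    proof -
      obtain d where "x = (\<Sum>j<i. d j *s ?g j)"
        using x by (rule rangeE)
      then show ?thesis
        by (intro range_eqI[of _ _ "\<lambda>j. c * d j"]) (simp add: vec.scale_sum_right)
    qed
  qed
  moreover have "?g ` {..<i} \<subseteq> ?W"
  proof clarify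
    fix j assume "j < i"
    then show "?g j \<in> ?W"
      by (intro range_eqI[of _ _ "\<lambda>k. if k = j then 1 else 0"]) (simp add: if_distrib[of "\<lambda>c. c *s _"] cong: if_cong)
  qed
  ultimately obtain c where c: "?g i = (\<Sum>j<i. c j *s ?g j)"
    using i vec.span_minimal[of "?g ` {..<i}" ?W] by blast
  define p where "p = monom 1 i - (\<Sum>j<i. monom (c j) j)"
  have coeff: "coeff p k = (if k = i then 1 else if k < i then - c k else 0)" for k
    by (auto simp: p_def coeff_sum)
  have "degree p = i"
    by (rule antisym) (auto intro!: degree_le le_degree simp: coeff)
  moreover have "(\<Sum>k\<le>i. coeff p k *s ?g k) = (\<Sum>k<i. coeff p k *s ?g k) + coeff p i *s ?g i"
    by (simp flip: lessThan_Suc_atMost)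
  then have "(\<Sum>k\<le>i. coeff p k *s ?g k) = 0"
    by (simp add: coeff c sum_negf)
  moreover have "p \<noteq> 0"
    using coeff[of i] by auto
  ultimately show ?thesis
    using that by blast
qed

text \<open>Split a root c off a polynomial p with p(f) t = 0, say p = (X - c) q, and put y = q(f)
  t. Then f y = c y, so either y is the eigenvector or q is an annihilating polynomial of lower
  degree. Degree 0 is impossible because t is nonzero.\<close>

lemma eigenvector_exists:
  fixes f :: "complex^'n::finite \<Rightarrow> complex^'n"
  assumes lin: "Vector_Spaces.linear (*s) (*s) f" and K: "vec.subspace K" "\<And>x. x \<in> K \<Longrightarrow> f x \<in> K"
    and t: "t \<in> K" "t \<noteq> 0"
  obtains c x where "x \<in> K" "x \<noteq> 0" "f x = c *s x"
proof -
  have "\<exists>c. \<exists>x\<in>K. x \<noteq> 0 \<and> f x = c *s x"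
    if "degree p = d" "p \<noteq> 0" "(\<Sum>i\<le>d. coeff p i *s (f ^^ i) t) = 0" for p d
    using that
  proof (induction d arbitrary: p)
    case 0
    then have "coeff p 0 \<noteq> 0"
      using leading_coeff_0_iff by metis
    then show ?case using 0 t by simp
  next
    case (Suc d)
    have "\<not> constant (poly p)"
      using Suc.prems(1) by (simp add: constant_degree)
    then obtain c where "poly p c = 0"
      using fundamental_theorem_of_algebra by blast
    then obtain q where q: "p = [:- c, 1:] * q"
      using poly_eq_0_iff_dvd by blast
    with Suc.prems have "q \<noteq> 0" by auto
    then have dq: "degree q = d"
      using Suc.prems(1) degree_mult_eq[of "[:- c, 1:]" q] by (simp add: q del: mult_pCons_left)
    let ?y = "\<Sum>i\<le>d. coeff q i *s (f ^^ i) t"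
    have "(\<Sum>i\<le>Suc d. coeff (pCons 0 q) i *s (f ^^ i) t) = f ?y"
      by (simp add: sum.atMost_Suc_shift vec.linear_sum[OF lin] vec.linear_scale[OF lin] del: sum.atMost_Suc)
    moreover have "(\<Sum>i\<le>Suc d. coeff (smult c q) i *s (f ^^ i) t) = c *s ?y"
      using dq by (simp add: coeff_eq_0 vec.scale_sum_right)
    moreover have "coeff p i = coeff (pCons 0 q) i - coeff (smult c q) i" for i
      by (simp add: q)
    ultimately have "f ?y - c *s ?y = (\<Sum>i\<le>Suc d. coeff p i *s (f ^^ i) t)"
      by (simp only: vec.scale_left_diff_distrib sum_subtractf)
    then have "f ?y = c *s ?y"
      using Suc.prems(3) by (simp only: right_minus_eq)
    moreover have "(f ^^ i) t \<in> K" for i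
      by (induction i) (auto simp: t K)
    then have "?y \<in> K"
      by (intro vec.subspace_sum K vec.subspace_scale)
    ultimately show ?case
      using Suc.IH[OF dq \<open>q \<noteq> 0\<close>] by blast
  qed
  then show ?thesis
    using poly_annihilates_vector[of f t] that by metis
qed

section \<open>Matrix units in semisimple algebras\<close>

lemma prodl_append: "prodl \<mu> x (ys @ zs) = prodl \<mu> (prodl \<mu> x ys) zs"
  by (induction ys arbitrary: x) auto

lemma mult_prodl: "assoc_alg \<mu> \<Longrightarrow> \<mu> y (prodl \<mu> x ys) = prodl \<mu> (\<mu> y x) ys"
  by (induction ys arbitrary: x) (auto simp: assoc_alg_def)

lemma prodl_in_ideal: "alg_ideal \<mu> I \<Longrightarrow> x \<in> I \<Longrightarrow> prodl \<mu> x ys \<in> I"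
  by (induction ys arbitrary: x) (auto simp: alg_ideal_def)

text \<open>The annihilator of a nonzero nilpotent ideal I inside I is an ideal of square zero; it is
  nonzero because it contains the nonzero products of maximal length.\<close>

lemma semisimple_iff_no_square_zero_ideal:
  assumes bil: "cbilinear \<mu>" and assoc: "assoc_alg \<mu>"
  shows "semisimple \<mu> \<longleftrightarrow>
    (\<forall>J. alg_ideal \<mu> J \<longrightarrow> (\<forall>x\<in>J. \<forall>y\<in>J. \<mu> x y = 0) \<longrightarrow> J \<subseteq> {0})"
proof
  assume ss: "semisimple \<mu>"
  show "\<forall>J. alg_ideal \<mu> J \<longrightarrow> (\<forall>x\<in>J. \<forall>y\<in>J. \<mu> x y = 0) \<longrightarrow> J \<subseteq> {0}"
  proof (intro allI impI)
    fix J assume J: "alg_ideal \<mu> J" "\<forall>x\<in>J. \<forall>y\<in>J. \<mu> x y = 0"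
    then have "nilpotent_ideal \<mu> J"
      \<comment> \<open>The witness is 1 rather than 2: \<open>prodl\<close> multiplies one more
        element than its list contains.\<close>
      unfolding nilpotent_ideal_def by (intro conjI exI[of _ 1]) (auto simp: length_Suc_conv)
    then show "J \<subseteq> {0}"
      using ss by (simp add: semisimple_def)
  qed
next
  assume no: "\<forall>J. alg_ideal \<mu> J \<longrightarrow> (\<forall>x\<in>J. \<forall>y\<in>J. \<mu> x y = 0) \<longrightarrow> J \<subseteq> {0}"
  have lin: "Vector_Spaces.linear (*s) (*s) (\<mu> x)" "Vector_Spaces.linear (*s) (*s) (\<lambda>x. \<mu> x y)" for x y
    using bil by (auto simp: cbilinear_def)
  show "semisimple \<mu>"
    unfolding semisimple_def
  proof (intro allI impI)
    fix I assume nil: "nilpotent_ideal \<mu> I"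
    then have I: "alg_ideal \<mu> I" by (simp add: nilpotent_ideal_def)
    define Q where "Q m \<longleftrightarrow> (\<forall>x\<in>I. \<forall>ys. length ys = m \<and> set ys \<subseteq> I \<longrightarrow> prodl \<mu> x ys = 0)" for m
    define m where "m = (LEAST m. Q m)"
    have "\<exists>m. Q m" using nil by (simp add: nilpotent_ideal_def Q_def)
    then have Qm: "Q m" and least: "\<And>k. k < m \<Longrightarrow> \<not> Q k"
      unfolding m_def by (auto intro: LeastI_ex dest: not_less_Least)
    show "I \<subseteq> {0}"
    proof (cases m)
      case 0
      then show ?thesis using Qm by (auto simp: Q_def)
    next
      case (Suc k)
      then obtain x ys where x: "x \<in> I" "length ys = k" "set ys \<subseteq> I" "prodl \<mu> x ys \<noteq> 0"
        using least[of k] by (auto simp: Q_def)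
      define J where "J = {z\<in>I. \<forall>y\<in>I. \<mu> z y = 0 \<and> \<mu> y z = 0}"
      have "\<mu> (prodl \<mu> x ys) y = 0" if "y \<in> I" for y
        \<comment> \<open>One further factor on either side makes a product with a list of length m,
          which vanishes.\<close>
        using Qm[unfolded Q_def, rule_format, of x "ys @ [y]"] x that Suc by (simp add: prodl_append)
      moreover have "\<mu> y (prodl \<mu> x ys) = 0" if "y \<in> I" for y
        using Qm[unfolded Q_def, rule_format, of y "x # ys"] x that Suc by (simp add: mult_prodl assoc)
      ultimately have "prodl \<mu> x ys \<in> J"
        using x I by (simp add: J_def prodl_in_ideal)
      moreover have "alg_ideal \<mu> J"
        using I assoc unfolding alg_ideal_def csubspace_def J_def assoc_alg_def
        by (auto simp: vec.linear_add[OF lin(1)] vec.linear_add[OF lin(2)] vec.linear_scale[OF lin(1)]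
            vec.linear_scale[OF lin(2)] vec.linear_0[OF lin(1)] vec.linear_0[OF lin(2)]) metis+
      then have "J \<subseteq> {0}"
        using no by (auto simp: J_def)
      ultimately show ?thesis using x(4) by blast
    qed
  qed
qed

locale semisimple_algebra =
  fixes mult :: "'n::finite alg" (infixl "\<odot>" 70)
  assumes bil: "cbilinear mult" and assoc: "assoc_alg mult" and semisimple: "semisimple mult"
begin

lemma linear_mult: "Vector_Spaces.linear (*s) (*s) (\<lambda>y. x \<odot> y)" "Vector_Spaces.linear (*s) (*s) (\<lambda>x. x \<odot> y)"
  using bil by (auto simp: cbilinear_def)

lemmas mult_add_right = vec.linear_add[OF linear_mult(1)]
  and mult_add_left = vec.linear_add[OF linear_mult(2)]
  and mult_diff_right = vec.linear_diff[OF linear_mult(1)]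
  and mult_diff_left = vec.linear_diff[OF linear_mult(2)]
  and mult_scale_right = vec.linear_scale[OF linear_mult(1)]
  and mult_scale_left = vec.linear_scale[OF linear_mult(2)]
  and mult_zero_right = vec.linear_0[OF linear_mult(1)]
  and mult_zero_left = vec.linear_0[OF linear_mult(2)]
  and mult_sum_right = vec.linear_sum[OF linear_mult(1)]
  and mult_sum_left = vec.linear_sum[OF linear_mult(2)]

lemmas mult_simps = mult_add_right mult_add_left mult_diff_right mult_diff_left
  mult_scale_right mult_scale_left mult_zero_right mult_zero_left

lemma mult_assoc: "(x \<odot> y) \<odot> z = x \<odot> (y \<odot> z)"
  using assoc by (simp add: assoc_alg_def)

lemma square_zero_ideal_trivial:
  assumes "vec.subspace J" "\<And>x y. x \<in> J \<Longrightarrow> x \<odot> y \<in> J" "\<And>x y. x \<in> J \<Longrightarrow> y \<odot> x \<in> J"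
    and "\<And>x y. x \<in> J \<Longrightarrow> y \<in> J \<Longrightarrow> x \<odot> y = 0"
  shows "J \<subseteq> {0}"
  using semisimple assms unfolding semisimple_iff_no_square_zero_ideal[OF bil assoc]
  by (auto simp: alg_ideal_def csubspace_def vec.subspace_def)

text \<open>Such elements form a two-sided ideal of square zero. Before a unit is available, this is
  what guarantees that x.A is nonzero for nonzero x.\<close>

lemma left_annihilator_trivial:
  assumes "\<And>a. x \<odot> a = 0"
  shows "x = 0"
proof -
  have "{x. \<forall>a. x \<odot> a = 0} \<subseteq> {0}"
    by (rule square_zero_ideal_trivial) (auto simp: vec.subspace_def mult_simps mult_assoc)
  then show ?thesis using assms by blast
qed

section \<open>Minimal right ideals and primitive idempotents\<close>

definition right_ideal :: "(complex^'n) set \<Rightarrow> bool" where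
  "right_ideal K \<longleftrightarrow> vec.subspace K \<and> (\<forall>x\<in>K. \<forall>a. x \<odot> a \<in> K)"

definition minimal_right_ideal :: "(complex^'n) set \<Rightarrow> bool" where
  "minimal_right_ideal K \<longleftrightarrow> right_ideal K \<and> K \<noteq> {0} \<and>
     (\<forall>K'. right_ideal K' \<longrightarrow> K' \<subseteq> K \<longrightarrow> K' = {0} \<or> K' = K)"

lemma right_ideal_0: "right_ideal K \<Longrightarrow> 0 \<in> K"
  by (auto simp: right_ideal_def vec.subspace_0)

lemma right_ideal_image:
  assumes "right_ideal K"
  shows "right_ideal ((\<lambda>x. a \<odot> x) ` K)"
  using assms vec.linear_subspace_image[OF linear_mult(1), of K a]
  by (auto simp: right_ideal_def mult_assoc)

lemma right_ideal_kernel: "right_ideal K \<Longrightarrow> right_ideal {x\<in>K. a \<odot> x = 0}"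
  by (auto simp: right_ideal_def vec.subspace_def mult_simps simp flip: mult_assoc)

lemma right_ideal_UNIV: "right_ideal UNIV"
  by (simp add: right_ideal_def vec.subspace_UNIV)

text \<open>The right annihilator Z of a right ideal K with K.K = 0 is a two-sided ideal containing K,
  and the elements of Z annihilating Z from the left form an ideal of square zero containing K.\<close>

lemma right_ideal_square_nonzero:
  assumes K: "right_ideal K" "K \<noteq> {0}"
  obtains a b where "a \<in> K" "b \<in> K" "a \<odot> b \<noteq> 0"
proof (rule ccontr)
  assume "\<not> thesis"
  then have sq0: "\<forall>a\<in>K. \<forall>b\<in>K. a \<odot> b = 0"
    using that by blast
  define Z where "Z = {x. \<forall>k\<in>K. k \<odot> x = 0}"
  have Z: "x \<odot> a \<in> Z" "a \<odot> x \<in> Z" if "x \<in> Z" for x a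
    using that K by (auto simp: Z_def right_ideal_def mult_simps simp flip: mult_assoc)
  have "{x\<in>Z. \<forall>z\<in>Z. x \<odot> z = 0} \<subseteq> {0}"
  proof (rule square_zero_ideal_trivial)
    show "vec.subspace {x\<in>Z. \<forall>z\<in>Z. x \<odot> z = 0}"
      by (auto simp: vec.subspace_def mult_simps Z_def)
  qed (auto simp: Z mult_assoc mult_simps)
  moreover have "K \<subseteq> {x\<in>Z. \<forall>z\<in>Z. x \<odot> z = 0}"
    by (auto simp: Z_def sq0)
  ultimately show False
    using K right_ideal_0 by blast
qed

text \<open>A nonzero right ideal of least dimension inside R is minimal, since nested subspaces of
  equal dimension coincide.\<close>

lemma minimal_right_ideal_exists:
  assumes R: "right_ideal R" "R \<noteq> {0}"
  obtains K where "minimal_right_ideal K" "K \<subseteq> R"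
proof -
  define Q where "Q K \<longleftrightarrow> right_ideal K \<and> K \<noteq> {0} \<and> K \<subseteq> R" for K
  have "Q R" using R by (simp add: Q_def)
  then obtain K where K: "Q K" "\<And>K'. Q K' \<Longrightarrow> vec.dim K \<le> vec.dim K'"
    using ex_has_least_nat[of Q R vec.dim] by blast
  have "K' = K" if "right_ideal K'" "K' \<subseteq> K" "K' \<noteq> {0}" for K'
  proof (rule vec.subspace_dim_equal)
    show "vec.dim K' \<ge> vec.dim K"
      using that K by (auto simp: Q_def)
  qed (use that K in \<open>auto simp: Q_def right_ideal_def\<close>)
  then have "minimal_right_ideal K"
    using K(1) unfolding Q_def minimal_right_ideal_def by blast
  then show ?thesis
    using K(1) that by (simp add: Q_def)
qed

text \<open>The third clause says that every nonzero element of e.A generates the right ideal e.A,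
  i.e. that e.A is a minimal right ideal.\<close>

definition primitive :: "complex^'n \<Rightarrow> bool" where
  "primitive e \<longleftrightarrow> e \<noteq> 0 \<and> e \<odot> e = e \<and> (\<forall>a. e \<odot> a = a \<and> a \<noteq> 0 \<longrightarrow> (\<exists>b. a \<odot> b = e))"

text \<open>Brauer's lemma. If a.K is nonzero for some a in K, minimality makes left multiplication
  by a bijective on K. The solution e in K of a.e = a is then idempotent, because a kills e.e -
  e.\<close>

lemma primitive_in_minimal_right_ideal:
  assumes K: "minimal_right_ideal K"
  obtains e where "e \<in> K" "primitive e"
proof -
  have Kr: "right_ideal K" "K \<noteq> {0}"
    and min: "\<And>K'. right_ideal K' \<Longrightarrow> K' \<subseteq> K \<Longrightarrow> K' \<noteq> {0} \<Longrightarrow> K' = K"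
    using K by (auto simp: minimal_right_ideal_def)
  obtain a y where a: "a \<in> K" "y \<in> K" "a \<odot> y \<noteq> 0"
    using right_ideal_square_nonzero[OF Kr] .
  have "(\<lambda>x. a \<odot> x) ` K = K"
    using a Kr by (intro min right_ideal_image) (auto simp: right_ideal_def)
  then obtain e where e: "e \<in> K" "a \<odot> e = a"
    using a(1) by (metis imageE)
  have ker: "x = 0" if "x \<in> K" "a \<odot> x = 0" for x
  proof -
    have "{x\<in>K. a \<odot> x = 0} = {0}"
      using min[OF right_ideal_kernel[OF Kr(1), of a]] a by blast
    then show ?thesis using that by blast
  qed
  have "e \<odot> e - e \<in> K"
    using e Kr(1) by (auto simp: right_ideal_def intro: vec.subspace_diff)
  then have "e \<odot> e = e"
    using ker[of "e \<odot> e - e"] e by (simp add: mult_simps flip: mult_assoc)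
  moreover have "e \<noteq> 0"
    using a e mult_simps by metis
  \<comment> \<open>Such an x lies in K, and x.A is a nonzero right ideal inside K, hence equal to K
    and containing e.\<close>
  moreover have "\<exists>b. x \<odot> b = e" if "e \<odot> x = x" "x \<noteq> 0" for x
  proof -
    have "x \<in> K" using e(1) Kr(1) that(1) unfolding right_ideal_def by metis
    moreover have "range (\<lambda>y. x \<odot> y) \<noteq> {0}"
      using left_annihilator_trivial[of x] that(2) by blast
    ultimately have "range (\<lambda>y. x \<odot> y) = K"
      using Kr(1) by (intro min right_ideal_image right_ideal_UNIV) (auto simp: right_ideal_def)
    then show ?thesis using e(1) by (metis imageE)
  qed
  ultimately show ?thesis
    using that e(1) by (auto simp: primitive_def)
qed

text \<open>Schur's lemma for the right ideal e.A: left multiplication by e.x.e has an eigenvector t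
  in it, with eigenvalue c. Primitivity provides b with t.b = e, and multiplying the eigenvalue
  equation by b gives the claim.\<close>

lemma primitive_corner:
  assumes e: "primitive e"
  obtains c where "e \<odot> x \<odot> e = c *s e"
proof -
  let ?f = "\<lambda>t. (e \<odot> x \<odot> e) \<odot> t" and ?K = "{t. e \<odot> t = t}"
  have ee: "e \<odot> e = e" "e \<odot> (e \<odot> y) = e \<odot> y" "e \<noteq> 0" for y
    using e by (auto simp: primitive_def simp flip: mult_assoc)
  have "vec.subspace ?K"
    by (auto simp: vec.subspace_def mult_simps)
  moreover have "?f t \<in> ?K" for t
    by (simp add: mult_assoc ee)
  moreover have "e \<in> ?K" using ee by simp
  ultimately obtain c t where t: "t \<in> ?K" "t \<noteq> 0" "?f t = c *s t"
    using eigenvector_exists[OF linear_mult(1), of ?K "e \<odot> x \<odot> e" e] ee(3) by blast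
  then obtain b where b: "t \<odot> b = e"
    using e by (auto simp: primitive_def)
  have "e \<odot> x \<odot> e = ?f t \<odot> b"
    using b by (simp add: mult_assoc ee)
  also have "\<dots> = c *s e"
    by (simp add: t(3) mult_simps b)
  finally show ?thesis by (rule that)
qed

text \<open>Write e' for e - e.f, formally e.(1 - f). From e'.e = e and e.e' = e' both generate the
  same right ideal, so primitivity carries over.\<close>

lemma primitive_orthogonalize:
  assumes e: "primitive e" and f: "f \<odot> f = f" "f \<odot> e = 0"
  shows "primitive (e - e \<odot> f)" "f \<odot> (e - e \<odot> f) = 0" "(e - e \<odot> f) \<odot> f = 0"
proof -
  let ?e = "e - e \<odot> f"
  have ee: "e \<odot> e = e" "e \<odot> (e \<odot> y) = e \<odot> y" "e \<noteq> 0" for y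
    using e by (auto simp: primitive_def simp flip: mult_assoc)
  have fe: "f \<odot> (e \<odot> y) = 0" "f \<odot> (f \<odot> y) = f \<odot> y" for y
    using f by (simp_all add: mult_simps flip: mult_assoc)
  show "f \<odot> ?e = 0" "?e \<odot> f = 0"
    by (simp_all add: mult_simps mult_assoc f fe)
  have e'e: "?e \<odot> e = e" "e \<odot> ?e = ?e"
    by (simp_all add: mult_simps mult_assoc f ee)
  have "\<exists>b. a \<odot> b = ?e" if a: "?e \<odot> a = a" "a \<noteq> 0" for a
  proof -
    have "e \<odot> a = a"
      using a(1) e'e by (metis mult_assoc)
    then obtain b where "a \<odot> b = e"
      using e a(2) by (auto simp: primitive_def)
    then have "a \<odot> (b \<odot> ?e) = ?e"
      using e'e by (simp flip: mult_assoc)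
    then show ?thesis by blast
  qed
  moreover have "?e \<noteq> 0"
    using e'e ee(3) by (metis mult_zero_left)
  moreover have "?e \<odot> ?e = ?e"
    by (simp add: mult_simps mult_assoc f fe ee)
  ultimately show "primitive ?e"
    by (auto simp: primitive_def)
qed

section \<open>Orthogonal primitive idempotents, the unit and matrix units\<close>

definition orthogonal_primitives :: "(complex^'n) set \<Rightarrow> bool" where
  "orthogonal_primitives S \<longleftrightarrow> (\<forall>e\<in>S. primitive e) \<and> (\<forall>e\<in>S. \<forall>e'\<in>S. e \<noteq> e' \<longrightarrow> e \<odot> e' = 0)"

text \<open>Multiplying a linear relation by one member isolates its coefficient. Independence
  bounds the size of such families by n, so one of maximal size exists.\<close>

lemma orthogonal_primitives_independent:
  assumes S: "orthogonal_primitives S"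
  shows "vec.independent S"
proof
  assume "vec.dependent S"
  then obtain T u v where T: "finite T" "T \<subseteq> S" "(\<Sum>w\<in>T. u w *s w) = 0" "v \<in> T" "u v \<noteq> 0"
    by (auto simp: vec.dependent_explicit)
  have v: "v \<odot> v = v" "v \<noteq> 0"
    using S T by (auto simp: orthogonal_primitives_def primitive_def)
  have "0 = v \<odot> (\<Sum>w\<in>T. u w *s w)"
    by (simp add: T mult_simps)
  also have "\<dots> = (\<Sum>w\<in>T. u w *s (v \<odot> w))"
    by (simp add: mult_sum_right mult_simps)
  also have "\<dots> = (\<Sum>w\<in>T. if w = v then u v *s v else 0)"
  proof (rule sum.cong)
    fix w assume "w \<in> T"
    then have "v \<odot> w = 0" if "w \<noteq> v"
      using S T that unfolding orthogonal_primitives_def by (metis subsetD)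
    then show "u w *s (v \<odot> w) = (if w = v then u v *s v else 0)"
      using v by simp
  qed simp
  also have "\<dots> = u v *s v" using T by simp
  finally show False using T v by simp
qed

text \<open>Let f be the sum of a family of maximal size. If f killed a nonzero x, the right ideal
  of vectors killed by f would contain a primitive idempotent, whose orthogonalization would enlarge
  the family. Hence f is a left unit, as f kills f.x - x.\<close>

lemma orthogonal_primitives_unit:
  obtains S where "finite S" "orthogonal_primitives S" "\<And>x. (\<Sum>S) \<odot> x = x" "\<And>x. x \<odot> (\<Sum>S) = x"
proof -
  have fin: "finite S" and "card S \<le> CARD('n)" if "orthogonal_primitives S" for S
    using vec.independent_bound_general[OF orthogonal_primitives_independent[OF that]]
      vec.dim_subset_UNIV[of S] by (auto simp: vec.dimension_def card_cart_basis)
  then have bound: "card S < Suc (CARD('n))" if "orthogonal_primitives S" for S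
    using that by (simp add: le_imp_less_Suc)
  have "orthogonal_primitives {}" by (simp add: orthogonal_primitives_def)
  from ex_has_greatest_nat[of orthogonal_primitives, OF this, of card] bound
  obtain S where S: "orthogonal_primitives S" and max: "\<And>T. orthogonal_primitives T \<Longrightarrow> card T \<le> card S"
    by blast
  define f where "f = \<Sum>S"
  have ee: "e \<odot> e = e" "e \<noteq> 0" if "e \<in> S" for e
    using S that by (auto simp: orthogonal_primitives_def primitive_def)
  have fe: "f \<odot> e = e" if "e \<in> S" for e
  proof -
    have "f \<odot> e = (\<Sum>e'\<in>S. if e' = e then e else 0)"
      unfolding f_def mult_sum_left using S that ee
      by (intro sum.cong) (auto simp: orthogonal_primitives_def)
    then show ?thesis using that fin[OF S] by simp
  qed
  have ef: "e \<odot> f = e" if "e \<in> S" for e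
  proof -
    have "e \<odot> f = (\<Sum>e'\<in>S. if e' = e then e else 0)"
      unfolding f_def mult_sum_right using S that ee
      by (intro sum.cong) (auto simp: orthogonal_primitives_def)
    then show ?thesis using that fin[OF S] by simp
  qed
  have ff: "f \<odot> f = f"
    using mult_sum_right[of f "\<lambda>x. x" S] fe by (simp add: f_def)
  have ker: "x = 0" if "f \<odot> x = 0" for x
  proof (rule ccontr)
    assume "x \<noteq> 0"
    with that have "{x\<in>UNIV. f \<odot> x = 0} \<noteq> {0}" by blast
    with right_ideal_kernel[OF right_ideal_UNIV] obtain K
      where K: "minimal_right_ideal K" "K \<subseteq> {x\<in>UNIV. f \<odot> x = 0}"
      by (rule minimal_right_ideal_exists)
    obtain e where "e \<in> K" "primitive e"
      by (rule primitive_in_minimal_right_ideal[OF K(1)])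
    then have e: "primitive e" "f \<odot> e = 0" using K(2) by auto
    let ?e = "e - e \<odot> f"
    note e' = primitive_orthogonalize[OF e(1) ff e(2)]
    \<comment> \<open>f fixes the members of S but kills the nonzero \<open>?e\<close>.\<close>
    have "?e \<notin> S" using e' fe by (metis primitive_def)
    have "s \<odot> ?e = 0" if "s \<in> S" for s
      using ef[OF that] e'(2) by (metis mult_assoc mult_zero_right)
    moreover have "?e \<odot> s = 0" if "s \<in> S" for s
      using fe[OF that] e'(3) by (metis mult_assoc mult_zero_left)
    ultimately have "orthogonal_primitives (insert ?e S)"
      using S e' by (auto simp: orthogonal_primitives_def)
    from max[OF this] show False
      using \<open>?e \<notin> S\<close> fin[OF S] by simp
  qed
  have fx: "f \<odot> x = x" for x
    using ker[of "f \<odot> x - x"] by (simp add: mult_simps ff flip: mult_assoc)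
  \<comment> \<open>With f a left unit, x.f = 0 implies x.y = x.(f.y) = 0 for all y; so this is an
    ideal of square zero, and f is also a right unit.\<close>
  have "{x. x \<odot> f = 0} \<subseteq> {0}"
  proof (rule square_zero_ideal_trivial)
    have 0: "x \<odot> y = 0" if "x \<odot> f = 0" for x y
      using that fx[of y] by (metis mult_assoc mult_zero_left)
    show "x \<odot> y \<in> {x. x \<odot> f = 0}" "z \<in> {x. x \<odot> f = 0} \<Longrightarrow> x \<odot> z = 0" if "x \<in> {x. x \<odot> f = 0}" for x y z
      using that by (simp_all add: 0 mult_simps)
  qed (auto simp: vec.subspace_def mult_simps mult_assoc)
  moreover have "(x \<odot> f - x) \<odot> f = 0" for x
    by (simp add: mult_simps mult_assoc ff)
  ultimately have "x \<odot> f = x" for x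
    by (metis (mono_tags, lifting) eq_iff_diff_eq_0 mem_Collect_eq singletonD subsetD)
  then show ?thesis
    using that S fin fx f_def by blast
qed

text \<open>Primitivity of i gives a right inverse of a, which is cut down to j.A.i. The other
  product b.a lies in j.A.j, so it is c j, and a = a.b.a = c a forces c = 1.\<close>

lemma primitive_isomorphism:
  assumes i: "primitive i" and j: "primitive j" and a: "i \<odot> a = a" "a \<odot> j = a" "a \<noteq> 0"
  obtains b where "j \<odot> b = b" "b \<odot> i = b" "a \<odot> b = i" "b \<odot> a = j"
proof -
  have ii: "i \<odot> i = i" "i \<noteq> 0" and jj: "j \<odot> j = j" "\<And>x. j \<odot> (j \<odot> x) = j \<odot> x"
    using i j by (auto simp: primitive_def simp flip: mult_assoc)
  obtain b0 where b0: "a \<odot> b0 = i"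
    using i a by (auto simp: primitive_def)
  define b where "b = j \<odot> b0 \<odot> i"
  have b: "j \<odot> b = b" "b \<odot> i = b"
    by (simp_all add: b_def mult_assoc ii jj)
  have ab: "a \<odot> b = i"
    using a b0 ii by (simp add: b_def flip: mult_assoc)
  obtain c where c: "j \<odot> (b \<odot> a) \<odot> j = c *s j"
    using primitive_corner[OF j] .
  have ba: "b \<odot> a = c *s j"
    using c a b by (simp add: mult_assoc flip: mult_assoc[of j b])
  have "a = a \<odot> b \<odot> a"
    by (simp add: ab a)
  also have "\<dots> = c *s a"
    by (simp add: mult_assoc ba mult_simps a)
  finally have "(c - 1) *s a = 0"
    by (simp add: vec.scale_left_diff_distrib)
  then have "c - 1 = 0"
    using a(3) vec.scale_eq_0_iff by blast
  then have "c = 1" by simp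
  with ba have "b \<odot> a = j" by simp
  then show ?thesis
    using that b ab by blast
qed

text \<open>Inverse pairs chosen separately for all i and j need not compose consistently. Instead
  each i is linked once to the representative \<open>r i\<close> of its class, and
  \<open>E i j\<close> runs from i to j through that representative. The classes are the simple
  blocks.\<close>

lemma matrix_units_exist:
  obtains I :: "(complex^'n) set" and r :: "complex^'n \<Rightarrow> complex^'n" and E
  where "finite I"
    "\<And>i j k l. i \<in> I \<Longrightarrow> j \<in> I \<Longrightarrow> k \<in> I \<Longrightarrow> l \<in> I \<Longrightarrow> r i = r j \<Longrightarrow> r k = r l \<Longrightarrow>
      E i j \<odot> E k l = (if j = k then E i l else 0)"
    "\<And>i j. i \<in> I \<Longrightarrow> j \<in> I \<Longrightarrow> r i = r j \<Longrightarrow> E i j \<noteq> 0"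
    "\<And>x. x \<in> vec.span {E i j |i j. i \<in> I \<and> j \<in> I \<and> r i = r j}"
proof -
  obtain S where fin: "finite S" and S: "orthogonal_primitives S"
    and unit: "\<And>x. (\<Sum>S) \<odot> x = x" "\<And>x. x \<odot> (\<Sum>S) = x"
    using orthogonal_primitives_unit by metis
  have prim: "primitive i" if "i \<in> S" for i
    using S that by (simp add: orthogonal_primitives_def)
  have ii: "i \<odot> i = i" "i \<noteq> 0" "i \<odot> (i \<odot> x) = i \<odot> x" if "i \<in> S" for i x
    using prim[OF that] by (auto simp: primitive_def simp flip: mult_assoc)
  have orth: "i \<odot> j = 0" if "i \<in> S" "j \<in> S" "i \<noteq> j" for i j
    using S that by (auto simp: orthogonal_primitives_def)
  \<comment> \<open>The elements u and v express an isomorphism of the right ideals i.A and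
    j.A.\<close>
  define inverse_pair where "inverse_pair i j u v \<longleftrightarrow> i \<odot> u = u \<and> u \<odot> j = u \<and>
    j \<odot> v = v \<and> v \<odot> i = v \<and> u \<odot> v = i \<and> v \<odot> u = j" for i j u v
  define linked where "linked i j \<longleftrightarrow> (\<exists>u v. inverse_pair i j u v)" for i j
  have linkedI: "linked i j" if ij: "i \<in> S" "j \<in> S" "i \<odot> x \<odot> j \<noteq> 0" for i j x
  proof -
    have u: "i \<odot> (i \<odot> x \<odot> j) = i \<odot> x \<odot> j" "i \<odot> x \<odot> j \<odot> j = i \<odot> x \<odot> j"
      using ij by (simp_all add: mult_assoc ii)
    obtain v where "j \<odot> v = v" "v \<odot> i = v" "i \<odot> x \<odot> j \<odot> v = i" "v \<odot> (i \<odot> x \<odot> j) = j"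
      by (rule primitive_isomorphism[OF prim[OF ij(1)] prim[OF ij(2)] u ij(3)])
    then show ?thesis
      unfolding linked_def inverse_pair_def using u by (intro exI[of _ "i \<odot> x \<odot> j"] exI[of _ v] conjI)
  qed
  have refl: "linked i i" if "i \<in> S" for i
    unfolding linked_def inverse_pair_def using ii(1)[OF that] by (intro exI[of _ i] conjI)
  have sym: "linked j i" if "linked i j" for i j
    using that unfolding linked_def inverse_pair_def by blast
  have trans: "linked i k" if ij: "linked i j" and jk: "linked j k" for i j k
  proof -
    obtain u v where u: "i \<odot> u = u" "u \<odot> j = u" "j \<odot> v = v" "v \<odot> i = v" "u \<odot> v = i" "v \<odot> u = j"
      using ij unfolding linked_def inverse_pair_def by blast
    obtain u' v' where u': "j \<odot> u' = u'" "u' \<odot> k = u'" "k \<odot> v' = v'" "v' \<odot> j = v'" "u' \<odot> v' = j" "v' \<odot> u' = k"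
      using jk unfolding linked_def inverse_pair_def by blast
    have "u \<odot> u' \<odot> (v' \<odot> v) = u \<odot> (u' \<odot> v') \<odot> v" "v' \<odot> v \<odot> (u \<odot> u') = v' \<odot> (v \<odot> u) \<odot> u'"
      by (simp_all only: mult_assoc)
    then have "u \<odot> u' \<odot> (v' \<odot> v) = i" "v' \<odot> v \<odot> (u \<odot> u') = k"
      by (simp_all only: u u')
    moreover have "i \<odot> (u \<odot> u') = u \<odot> u'" "k \<odot> (v' \<odot> v) = v' \<odot> v"
      by (simp_all only: u u' flip: mult_assoc)
    moreover have "u \<odot> u' \<odot> k = u \<odot> u'" "v' \<odot> v \<odot> i = v' \<odot> v"
      by (simp_all only: u u' mult_assoc)
    ultimately show ?thesis
      unfolding linked_def inverse_pair_def by (intro exI[of _ "u \<odot> u'"] exI[of _ "v' \<odot> v"] conjI)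
  qed
  define r where "r i = (SOME k. k \<in> S \<and> linked i k)" for i
  have r: "r i \<in> S" "linked i (r i)" if "i \<in> S" for i
    using someI[of "\<lambda>k. k \<in> S \<and> linked i k" i] refl that by (auto simp: r_def)
  have r_eq: "r i = r j" if "linked i j" for i j
  proof -
    \<comment> \<open>Equal predicates make \<open>SOME\<close> choose the same representative for
      linked elements.\<close>
    have "(\<lambda>k. k \<in> S \<and> linked i k) = (\<lambda>k. k \<in> S \<and> linked j k)"
      using that sym trans by blast
    then show ?thesis by (simp add: r_def)
  qed
  from r(2) have "\<forall>i\<in>S. \<exists>u v. inverse_pair i (r i) u v"
    by (simp add: linked_def)
  then obtain u v where "\<And>i. i \<in> S \<Longrightarrow> inverse_pair i (r i) (u i) (v i)"
    by metis
  then have uv: "\<And>i. i \<in> S \<Longrightarrow> i \<odot> u i = u i" "\<And>i. i \<in> S \<Longrightarrow> u i \<odot> r i = u i"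
      "\<And>i. i \<in> S \<Longrightarrow> r i \<odot> v i = v i" "\<And>i. i \<in> S \<Longrightarrow> v i \<odot> i = v i"
      "\<And>i. i \<in> S \<Longrightarrow> u i \<odot> v i = i" "\<And>i. i \<in> S \<Longrightarrow> v i \<odot> u i = r i"
    by (simp_all add: inverse_pair_def)
  define E where "E i j = u i \<odot> v j" for i j
  have mult: "E i j \<odot> E k l = (if j = k then E i l else 0)"
    if "i \<in> S" "j \<in> S" "k \<in> S" "l \<in> S" "r i = r j" "r k = r l" for i j k l
  proof (cases "j = k")
    case True
    then have "E i j \<odot> E k l = u i \<odot> (v j \<odot> u j) \<odot> v l"
      by (simp add: E_def mult_assoc)
    also have "\<dots> = u i \<odot> r i \<odot> v l"
      using that by (simp only: uv)
    also have "\<dots> = u i \<odot> v l"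
      using that(1) by (simp only: uv)
    finally show ?thesis
      using True by (simp add: E_def)
  next
    case False
    have "v j \<odot> u k = v j \<odot> j \<odot> (k \<odot> u k)"
      using that by (simp add: uv)
    also have "\<dots> = v j \<odot> (j \<odot> k \<odot> u k)"
      by (simp add: mult_assoc)
    also have "\<dots> = 0"
      using orth False that by (simp add: mult_simps)
    finally have "u i \<odot> (v j \<odot> u k) \<odot> v l = 0"
      by (simp add: mult_simps)
    then show ?thesis
      using False by (simp add: E_def mult_assoc)
  qed
  moreover have "E i j \<noteq> 0" if "i \<in> S" "j \<in> S" "r i = r j" for i j
  proof -
    have "E i j \<odot> E j i = E i i"
      using mult[OF that(1,2,2,1,3) that(3)[symmetric]] by simp
    also have "\<dots> = i"
      using that(1) by (simp add: E_def uv)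
    finally show ?thesis
      using ii(2)[OF that(1)] by (auto simp: mult_zero_left)
  qed
  moreover have "x \<in> vec.span {E i j |i j. i \<in> S \<and> j \<in> S \<and> r i = r j}" (is "_ \<in> vec.span ?B") for x
  proof -
    have corner: "i \<odot> x \<odot> j \<in> vec.span ?B" if ij: "i \<in> S" "j \<in> S" for i j
    proof (cases "i \<odot> x \<odot> j = 0")
      case True
      then show ?thesis by (simp add: vec.span_zero)
    next
      case False
      then have rij: "r i = r j"
        using linkedI r_eq ij by blast
      \<comment> \<open>Conjugating by the links moves i.x.j into the corner of the common
        representative, which is one-dimensional.\<close>
      obtain c where c: "r i \<odot> (v i \<odot> x \<odot> u j) \<odot> r i = c *s r i"
        using primitive_corner[OF prim[OF r(1)[OF ij(1)]]] .
      have "i \<odot> x \<odot> j = u i \<odot> v i \<odot> x \<odot> (u j \<odot> v j)"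
        using ij by (simp add: uv)
      also have "\<dots> = u i \<odot> r i \<odot> v i \<odot> x \<odot> (u j \<odot> r j \<odot> v j)"
        using ij by (simp add: uv)
      also have "\<dots> = u i \<odot> (r i \<odot> (v i \<odot> x \<odot> u j) \<odot> r i) \<odot> v j"
        by (simp add: mult_assoc rij)
      also have "\<dots> = c *s E i j"
        using ij by (simp add: c mult_simps uv E_def)
      finally have "i \<odot> x \<odot> j = c *s E i j" .
      moreover have "E i j \<in> ?B"
        using ij rij by blast
      ultimately show ?thesis
        by (simp only: vec.span_scale vec.span_base)
    qed
    \<comment> \<open>The Peirce decomposition of x.\<close>
    have "x = (\<Sum>S) \<odot> x \<odot> (\<Sum>S)"
      by (simp add: unit)
    also have "\<dots> = (\<Sum>i\<in>S. \<Sum>j\<in>S. i \<odot> x \<odot> j)"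
      by (simp only: mult_sum_left) (simp only: mult_sum_right)
    also have "\<dots> \<in> vec.span ?B"
      by (intro vec.span_sum corner)
    finally show ?thesis .
  qed
  ultimately show ?thesis
    using that fin by blast
qed

end

section \<open>Orthonormalized matrix units are critical\<close>

text \<open>Structure constants of a direct sum of matrix algebras in a rescaled basis of matrix units: the
  basis vector numbered p is t (a p) times the matrix unit at row a p and column b p, and rows
  belong to the same block iff they have the same value under r.\<close>

lemma Mmu_matrix_units:
  fixes \<mu> :: "'n::finite alg" and a b :: "'n \<Rightarrow> 'i" and r :: "'i \<Rightarrow> 'k" and t :: "'i \<Rightarrow> real"
  assumes bij: "bij_betw (\<lambda>p. (a p, b p)) UNIV {(i, j). i \<in> I \<and> j \<in> I \<and> r i = r j}" and fin: "finite I"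
    and t: "\<And>i. i \<in> I \<Longrightarrow> real (card {j\<in>I. r j = r i}) * (t i)\<^sup>2 = 1"
    and t_cong: "\<And>i j. r i = r j \<Longrightarrow> t i = t j"
    and \<mu>: "\<And>p q k. \<mu> (axis p 1) (axis q 1) $ k =
      (if b p = a q \<and> a k = a p \<and> b k = b q then of_real (t (a p)) else 0)"
  shows "Mmu \<mu> = (- 2) *\<^sub>R mat 1"
proof -
  have ab: "a p \<in> I" "b p \<in> I" "r (a p) = r (b p)" for p
    using bij_betwE[OF bij] by auto
  have eqI: "p = q" if "a p = a q" "b p = b q" for p q
    using bij_betw_imp_inj_on[OF bij] that by (auto simp: inj_on_def)
  have eq_iff_ab: "k = l \<longleftrightarrow> a k = a l \<and> b k = b l" for k l
    using eqI by blast
  have one: "(\<Sum>q\<in>UNIV. if i = a q \<and> j = b q then x else 0) = x"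
    if "i \<in> I" "j \<in> I" "r i = r j" for i j and x :: complex
  proof -
    have "(i, j) \<in> range (\<lambda>p. (a p, b p))"
      using bij_betw_imp_surj_on[OF bij] that by simp
    then obtain p where "i = a p" "j = b p" by auto
    then have "(\<Sum>q\<in>UNIV. if i = a q \<and> j = b q then x else 0) = (\<Sum>q\<in>UNIV. if p = q then x else 0)"
      using eqI by (intro sum.cong) auto
    then show ?thesis by simp
  qed
  \<comment> \<open>Every row, and likewise every column, of a block of size d has d positions; this
    is where the sums of d terms t^2 come from.\<close>
  have bij_row: "bij_betw b {p. a p = i} {j\<in>I. r j = r i}" if "i \<in> I" for i
    unfolding bij_betw_def
  proof
    show "inj_on b {p. a p = i}" using eqI by (auto simp: inj_on_def)
    show "b ` {p. a p = i} = {j\<in>I. r j = r i}"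
    proof
      show "{j\<in>I. r j = r i} \<subseteq> b ` {p. a p = i}"
      proof
        fix j assume "j \<in> {j\<in>I. r j = r i}"
        then have "(i, j) \<in> range (\<lambda>p. (a p, b p))"
          using bij_betw_imp_surj_on[OF bij] that by simp
        then show "j \<in> b ` {p. a p = i}" by auto
      qed
    qed (use ab in auto)
  qed
  have bij_col: "bij_betw a {p. b p = i} {j\<in>I. r j = r i}" if "i \<in> I" for i
    unfolding bij_betw_def
  proof
    show "inj_on a {p. b p = i}" using eqI by (auto simp: inj_on_def)
    show "a ` {p. b p = i} = {j\<in>I. r j = r i}"
    proof
      show "{j\<in>I. r j = r i} \<subseteq> a ` {p. b p = i}"
      proof
        fix j assume "j \<in> {j\<in>I. r j = r i}"
        then have "(j, i) \<in> range (\<lambda>p. (a p, b p))"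
          using bij_betw_imp_surj_on[OF bij] that by simp
        then show "j \<in> a ` {p. b p = i}" by auto
      qed
    qed (use ab in auto)
  qed
  have row: "(\<Sum>p\<in>UNIV. if a p = i then complex_of_real (t i) * complex_of_real (t i) else 0) = 1"
    and col: "(\<Sum>p\<in>UNIV. if b p = i then complex_of_real (t i) * complex_of_real (t i) else 0) = 1"
    if "i \<in> I" for i
  proof -
    have "complex_of_real (real (card {j\<in>I. r j = r i}) * (t i)\<^sup>2) = 1"
      using t[OF that] by simp
    then have 1: "of_nat (card {j\<in>I. r j = r i}) * (complex_of_real (t i) * complex_of_real (t i)) = 1"
      by (simp add: power2_eq_square)
    show "(\<Sum>p\<in>UNIV. if a p = i then complex_of_real (t i) * complex_of_real (t i) else 0) = 1"
      using 1 bij_betw_same_card[OF bij_row[OF that]] by (simp flip: sum.inter_filter)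
    show "(\<Sum>p\<in>UNIV. if b p = i then complex_of_real (t i) * complex_of_real (t i) else 0) = 1"
      using 1 bij_betw_same_card[OF bij_col[OF that]] by (simp flip: sum.inter_filter)
  qed
  \<comment> \<open>A product with nonzero k-th coordinate needs p in the row of k and then fixes q,
    so d pairs remain, each contributing t^2. Off the diagonal, no product has two nonzero
    coordinates.\<close>
  have LL: "(\<Sum>p\<in>UNIV. Lmat \<mu> (axis p 1) ** adj (Lmat \<mu> (axis p 1))) $ k $ l = (if k = l then 1 else 0)" for k l
  proof -
    have "(\<Sum>p\<in>UNIV. Lmat \<mu> (axis p 1) ** adj (Lmat \<mu> (axis p 1))) $ k $ l =
      (\<Sum>p\<in>UNIV. \<Sum>q\<in>UNIV. \<mu> (axis p 1) (axis q 1) $ k * cnj (\<mu> (axis p 1) (axis q 1) $ l))"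
      by (simp add: matrix_matrix_mult_def adj_def Lmat_def)
    also have "\<dots> = (\<Sum>p\<in>UNIV. if k = l \<and> a p = a k then of_real (t (a k)) * of_real (t (a k)) else 0)"
    proof (rule sum.cong[OF refl])
      fix p
      have "(\<Sum>q\<in>UNIV. \<mu> (axis p 1) (axis q 1) $ k * cnj (\<mu> (axis p 1) (axis q 1) $ l)) =
        (\<Sum>q\<in>UNIV. if b p = a q \<and> b k = b q then
          (if k = l \<and> a p = a k then of_real (t (a k)) * of_real (t (a k)) else 0) else 0)"
        by (rule sum.cong[OF refl]) (auto simp: \<mu> eq_iff_ab[of k l])
      also have "\<dots> = (if k = l \<and> a p = a k then of_real (t (a k)) * of_real (t (a k)) else 0)"
      proof (cases "a p = a k")
        case True
        then have "r (b p) = r (b k)" using ab by metis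
        then show ?thesis using one[of "b p" "b k"] ab by simp
      qed simp
      finally show "(\<Sum>q\<in>UNIV. \<mu> (axis p 1) (axis q 1) $ k * cnj (\<mu> (axis p 1) (axis q 1) $ l)) = \<dots>" .
    qed
    also have "\<dots> = (if k = l then 1 else 0)"
      using row[OF ab(1)[of k]] by (cases "k = l") simp_all
    finally show ?thesis .
  qed
  have L'L: "(\<Sum>p\<in>UNIV. adj (Lmat \<mu> (axis p 1)) ** Lmat \<mu> (axis p 1)) $ k $ l = (if k = l then 1 else 0)" for k l
  proof -
    have "(\<Sum>p\<in>UNIV. adj (Lmat \<mu> (axis p 1)) ** Lmat \<mu> (axis p 1)) $ k $ l =
      (\<Sum>p\<in>UNIV. \<Sum>q\<in>UNIV. cnj (\<mu> (axis p 1) (axis k 1) $ q) * \<mu> (axis p 1) (axis l 1) $ q)"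
      by (simp add: matrix_matrix_mult_def adj_def Lmat_def)
    also have "\<dots> = (\<Sum>p\<in>UNIV. if k = l \<and> b p = a k then of_real (t (a k)) * of_real (t (a k)) else 0)"
    proof (rule sum.cong[OF refl])
      fix p
      have "(\<Sum>q\<in>UNIV. cnj (\<mu> (axis p 1) (axis k 1) $ q) * \<mu> (axis p 1) (axis l 1) $ q) =
        (\<Sum>q\<in>UNIV. if a p = a q \<and> b k = b q then
          (if k = l \<and> b p = a k then of_real (t (a p)) * of_real (t (a p)) else 0) else 0)"
        by (rule sum.cong[OF refl]) (auto simp: \<mu> eq_iff_ab[of k l])
      also have "\<dots> = (if k = l \<and> b p = a k then of_real (t (a k)) * of_real (t (a k)) else 0)"
      proof (cases "b p = a k")
        case True
        \<comment> \<open>The structure constant involves the row of p; it equals t at the row of k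
          because both lie in one block.\<close>
        then have "r (a p) = r (b k)" "t (a p) = t (a k)" using ab t_cong by metis+
        then show ?thesis using one[of "a p" "b k"] ab by simp
      qed simp
      finally show "(\<Sum>q\<in>UNIV. cnj (\<mu> (axis p 1) (axis k 1) $ q) * \<mu> (axis p 1) (axis l 1) $ q) = \<dots>" .
    qed
    also have "\<dots> = (if k = l then 1 else 0)"
      using col[OF ab(1)[of k]] by (cases "k = l") simp_all
    finally show ?thesis .
  qed
  have R'R: "(\<Sum>p\<in>UNIV. adj (Rmat \<mu> (axis p 1)) ** Rmat \<mu> (axis p 1)) $ k $ l = (if k = l then 1 else 0)" for k l
  proof -
    have "(\<Sum>p\<in>UNIV. adj (Rmat \<mu> (axis p 1)) ** Rmat \<mu> (axis p 1)) $ k $ l =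
      (\<Sum>p\<in>UNIV. \<Sum>q\<in>UNIV. cnj (\<mu> (axis k 1) (axis p 1) $ q) * \<mu> (axis l 1) (axis p 1) $ q)"
      by (simp add: matrix_matrix_mult_def adj_def Rmat_def)
    also have "\<dots> = (\<Sum>p\<in>UNIV. if k = l \<and> a p = b k then of_real (t (b k)) * of_real (t (b k)) else 0)"
    proof (rule sum.cong[OF refl])
      fix p
      have "(\<Sum>q\<in>UNIV. cnj (\<mu> (axis k 1) (axis p 1) $ q) * \<mu> (axis l 1) (axis p 1) $ q) =
        (\<Sum>q\<in>UNIV. if a k = a q \<and> b p = b q then
          (if k = l \<and> a p = b k then of_real (t (a k)) * of_real (t (a k)) else 0) else 0)"
        by (rule sum.cong[OF refl]) (auto simp: \<mu> eq_iff_ab[of k l])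
      also have "\<dots> = (if k = l \<and> a p = b k then of_real (t (b k)) * of_real (t (b k)) else 0)"
      proof (cases "a p = b k")
        case True
        then have "r (a k) = r (b p)" "t (a k) = t (b k)" using ab t_cong by metis+
        then show ?thesis using one[of "a k" "b p"] ab by auto
      qed simp
      finally show "(\<Sum>q\<in>UNIV. cnj (\<mu> (axis k 1) (axis p 1) $ q) * \<mu> (axis l 1) (axis p 1) $ q) = \<dots>" .
    qed
    also have "\<dots> = (if k = l then 1 else 0)"
      using row[OF ab(2)[of k]] by (cases "k = l") simp_all
    finally show ?thesis .
  qed
  have "(\<Sum>p\<in>UNIV. Lmat \<mu> (axis p 1) ** adj (Lmat \<mu> (axis p 1))) = mat 1"
    "(\<Sum>p\<in>UNIV. adj (Lmat \<mu> (axis p 1)) ** Lmat \<mu> (axis p 1)) = mat 1"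
    "(\<Sum>p\<in>UNIV. adj (Rmat \<mu> (axis p 1)) ** Rmat \<mu> (axis p 1)) = mat 1"
    by (simp_all only: vec_eq_iff LL L'L R'R) (simp_all add: mat_def)
  then show ?thesis
    by (simp only: Mmu_def) (simp add: vec_eq_iff)
qed

lemma matrix_inv_mult:
  assumes "invertible A"
  shows "matrix_inv A ** A = mat 1" "A ** matrix_inv A = mat 1"
  using someI_ex[OF assms[unfolded invertible_def]] by (simp_all add: matrix_inv_def)

context semisimple_algebra
begin

text \<open>Take for g the inverse of the matrix h whose columns are the rescaled matrix units: then
  g sends these to the standard orthonormal basis, and \<open>gl_act g mult\<close> has the
  structure constants treated above.\<close>

lemma exists_Mmu_scalar:
  obtains g where "invertible g" "Mmu (gl_act g mult) = (- 2) *\<^sub>R mat 1"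
proof -
  obtain I :: "(complex^'n) set" and r :: "complex^'n \<Rightarrow> complex^'n" and E where fin: "finite I"
    and E_mult: "\<And>i j k l. i \<in> I \<Longrightarrow> j \<in> I \<Longrightarrow> k \<in> I \<Longrightarrow> l \<in> I \<Longrightarrow> r i = r j \<Longrightarrow> r k = r l \<Longrightarrow>
      E i j \<odot> E k l = (if j = k then E i l else 0)"
    and E_nz: "\<And>i j. i \<in> I \<Longrightarrow> j \<in> I \<Longrightarrow> r i = r j \<Longrightarrow> E i j \<noteq> 0"
    and E_span: "\<And>x. x \<in> vec.span {E i j |i j. i \<in> I \<and> j \<in> I \<and> r i = r j}"
    by (rule matrix_units_exist) blast
  let ?P = "{(i, j). i \<in> I \<and> j \<in> I \<and> r i = r j}" and ?B = "{E i j |i j. i \<in> I \<and> j \<in> I \<and> r i = r j}"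
  \<comment> \<open>Multiplying by \<open>E i i\<close> and \<open>E j j\<close> extracts the
    component along \<open>E i j\<close>; this yields both distinctness and independence of the
    matrix units.\<close>
  have corner: "E i i \<odot> E k l \<odot> E j j = (if k = i \<and> l = j then E i j else 0)"
    if "(i, j) \<in> ?P" "(k, l) \<in> ?P" for i j k l
    using that by (auto simp: E_mult mult_simps)
  have inj: "inj_on (case_prod E) ?P"
  proof (rule inj_onI; clarify)
    fix i j k l assume *: "i \<in> I" "j \<in> I" "r i = r j" "k \<in> I" "l \<in> I" "r k = r l" "E i j = E k l"
    then have P: "(i, j) \<in> ?P" "(k, l) \<in> ?P" by blast+
    have "E i i \<odot> E k l \<odot> E j j = E i j"
      using corner[OF P(1) P(1)] by (simp flip: *(7))
    then show "i = k \<and> j = l"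
      unfolding corner[OF P] using E_nz[OF *(1,2,3)] by (auto split: if_splits)
  qed
  have "vec.independent ?B"
  proof
    assume "vec.dependent ?B"
    then obtain T u v where T: "finite T" "T \<subseteq> ?B" "(\<Sum>w\<in>T. u w *s w) = 0" "v \<in> T" "u v \<noteq> 0"
      by (auto simp: vec.dependent_explicit)
    then obtain i j where ij: "v = E i j" "i \<in> I" "j \<in> I" "r i = r j"
      by blast
    have "0 = E i i \<odot> (\<Sum>w\<in>T. u w *s w) \<odot> E j j"
      by (simp add: T mult_simps)
    also have "\<dots> = (\<Sum>w\<in>T. u w *s (E i i \<odot> w \<odot> E j j))"
      by (simp add: mult_sum_right mult_sum_left mult_simps)
    also have "\<dots> = (\<Sum>w\<in>T. if w = v then u v *s v else 0)"
    proof (rule sum.cong[OF refl])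
      fix w assume "w \<in> T"
      then obtain k l where kl: "w = E k l" "k \<in> I" "l \<in> I" "r k = r l"
        using T by blast
      then have "w = v \<longleftrightarrow> k = i \<and> l = j"
        using inj_onD[OF inj, of "(k, l)" "(i, j)"] ij by auto
      moreover have "E i i \<odot> E k l \<odot> E j j = (if k = i \<and> l = j then E i j else 0)"
        using ij kl by (intro corner) blast+
      ultimately show "u w *s (E i i \<odot> w \<odot> E j j) = (if w = v then u v *s v else 0)"
        unfolding kl(1) ij(1) by simp
    qed
    also have "\<dots> = u v *s v" using T by simp
    finally show False
      using \<open>u v \<noteq> 0\<close> E_nz[OF ij(2-4)] by (simp add: ij(1))
  qed
  then have "card ?B = CARD('n)"
    using vec.basis_card_eq_dim[of ?B UNIV] E_span by (auto simp: card_cart_basis)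
  moreover have B: "?B = case_prod E ` ?P" by auto
  ultimately have "card ?P = CARD('n)"
    using card_image[OF inj] by simp
  moreover have "finite ?P"
    by (rule finite_subset[of _ "I \<times> I"]) (use fin in auto)
  \<comment> \<open>The matrix units form a basis, so there are n of them and the coordinates can
    number them.\<close>
  ultimately obtain \<sigma> :: "'n \<Rightarrow> _" where \<sigma>: "bij_betw \<sigma> UNIV ?P"
    using finite_same_card_bij[of "UNIV :: 'n set" ?P] by auto
  define a b where "a = fst \<circ> \<sigma>" and "b = snd \<circ> \<sigma>"
  define t where "t i = 1 / sqrt (real (card {j\<in>I. r j = r i}))" for i
  have bij: "bij_betw (\<lambda>p. (a p, b p)) UNIV ?P"
    using \<sigma> by (simp add: a_def b_def)
  have ab: "a p \<in> I" "b p \<in> I" "r (a p) = r (b p)" for p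
    using bij_betwE[OF bij] by auto
  have ab_eqI: "p = q" if "a p = a q" "b p = b q" for p q
    using bij_betw_imp_inj_on[OF bij] that by (auto simp: inj_on_def)
  have ab_surj: "\<exists>p. a p = i \<and> b p = j" if "(i, j) \<in> ?P" for i j
  proof -
    have "(i, j) \<in> range (\<lambda>p. (a p, b p))"
      using bij_betw_imp_surj_on[OF bij] that by simp
    then show ?thesis by auto
  qed
  have card_pos: "card {j\<in>I. r j = r i} > 0" if "i \<in> I" for i
    using that fin by (auto simp: card_gt_0_iff)
  have t_cong: "t i = t j" if "r i = r j" for i j
    using that by (simp add: t_def)
  define X where "X p = complex_of_real (t (a p)) *s E (a p) (b p)" for p
  define h :: "complex^'n^'n" where "h = (\<chi> k p. X p $ k)"
  have h: "h *v axis p 1 = X p" for p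
    by (simp add: h_def vec_eq_iff mult_axis_component)
  have "surj ((*v) h)"
  proof -
    have "E i j \<in> range ((*v) h)" if ij: "(i, j) \<in> ?P" for i j
    proof -
      obtain p where p: "a p = i" "b p = j"
        using ab_surj[OF ij] by blast
      have "h *v (complex_of_real (1 / t i) *s axis p 1) = E i j"
        using card_pos[of i] ij p unfolding vec.scale h X_def by (auto simp: t_def simp flip: of_real_mult)
      then show ?thesis by (metis rangeI)
    qed
    then have "?B \<subseteq> range ((*v) h)" by auto
    moreover have "vec.subspace (range ((*v) h))"
      by (simp add: vec.subspace_image vec.subspace_UNIV)
    ultimately show ?thesis
      using vec.span_minimal E_span by blast
  qed
  then have inv_h: "invertible h"
    by (simp add: invertible_right_inverse matrix_right_invertible_surjective)
  define g where "g = matrix_inv h"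
  have gh: "g ** h = mat 1" "h ** g = mat 1"
    using matrix_inv_mult[OF inv_h] by (simp_all add: g_def)
  then have inv_g: "invertible g"
    by (auto simp: invertible_def)
  have inv_g_eq: "matrix_inv g = h"
    using matrix_inv_mult[OF inv_g] gh by (metis matrix_mul_assoc matrix_mul_lid matrix_mul_rid)
  have "Mmu (gl_act g mult) = (- 2) *\<^sub>R mat 1"
  proof (rule Mmu_matrix_units[OF bij fin _ t_cong])
    show "real (card {j\<in>I. r j = r i}) * (t i)\<^sup>2 = 1" if "i \<in> I" for i
      using card_pos[OF that] by (simp add: t_def power_divide)
    show "gl_act g mult (axis p 1) (axis q 1) $ k =
      (if b p = a q \<and> a k = a p \<and> b k = b q then of_real (t (a p)) else 0)" for p q k
    proof -
      have E: "E (a p) (b p) \<odot> E (a q) (b q) = (if b p = a q then E (a p) (b q) else 0)"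
        by (intro E_mult ab)
      show ?thesis
      proof (cases "b p = a q")
        case True
        have r: "r (a p) = r (a q)"
          using ab(3)[of p] by (simp only: True)
        have "(a p, b q) \<in> ?P"
          using r ab(1)[of p] ab(2)[of q] ab(3)[of q] by simp
        then obtain m where m: "a m = a p" "b m = b q"
          using ab_surj by blast
        have "X p \<odot> X q = complex_of_real (t (a p)) *s X m"
          using E by (simp add: X_def mult_simps True m t_cong[OF r])
        then have "gl_act g mult (axis p 1) (axis q 1) = complex_of_real (t (a p)) *s (g *v (h *v axis m 1))"
          by (simp add: gl_act_def inv_g_eq h vec.scale)
        also have "\<dots> = complex_of_real (t (a p)) *s axis m 1"
          by (simp add: gh matrix_vector_mul_assoc)
        finally have "gl_act g mult (axis p 1) (axis q 1) $ k = (if k = m then of_real (t (a p)) else 0)"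
          by (simp add: axis_def)
        moreover have "k = m \<longleftrightarrow> a k = a p \<and> b k = b q"
          using ab_eqI[of k m] m by auto
        ultimately show ?thesis
          using True by simp
      next
        case False
        then show ?thesis
          by (simp add: gl_act_def inv_g_eq h X_def mult_simps E)
      qed
    qed
  qed
  then show ?thesis
    using that inv_g by blast
qed

end

section \<open>Minimizers of F\<close>

text \<open>The trace identity forces the value of c, so any scalar matrix gives the equality
  case.\<close>

lemma Fn_eq_of_Mmu_scalar:
  fixes \<mu> :: "'n::finite alg"
  assumes "Mmu \<mu> = c *\<^sub>R mat 1" and nz: "norm_sq_alg \<mu> \<noteq> 0"
  shows "Fn \<mu> = 4 / real CARD('n)"
proof -
  have "complex_of_real (c * real CARD('n)) = of_real (- 2 * norm_sq_alg \<mu>)"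
    using trace_Mmu[of \<mu>] by (simp add: assms trace_scaleR trace_I scaleR_conv_of_real[where 'a=complex])
  then have "c * real CARD('n) = - 2 * norm_sq_alg \<mu>"
    by (simp only: of_real_eq_iff)
  then have "c = - 2 * norm_sq_alg \<mu> / real CARD('n)"
    by (simp add: field_simps)
  then show ?thesis
    using assms Fn_eq_iff by metis
qed

lemma Fn_attains_bound:
  obtains \<nu> :: "'n::finite alg" where "cbilinear \<nu>" "assoc_alg \<nu>" "\<nu> \<noteq> (\<lambda>X Y. 0)" "Fn \<nu> = 4 / real CARD('n)"
proof -
  define \<nu> :: "'n alg" where "\<nu> = (\<lambda>X Y. \<chi> i. X $ i * Y $ i)"
  have bil: "cbilinear \<nu>"
    unfolding cbilinear_def Vector_Spaces.linear_iff
    by (intro allI conjI vec.vector_space_axioms) (simp_all add: \<nu>_def vec_eq_iff algebra_simps)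
  have as: "assoc_alg \<nu>"
    by (simp add: assoc_alg_def \<nu>_def mult.assoc)
  have "\<nu> (axis i 1) (axis i 1) $ i = 1" for i
    by (simp add: \<nu>_def)
  then have nz: "\<nu> \<noteq> (\<lambda>X Y. 0)"
    by (metis zero_index zero_neq_one)
  have "Mmu \<nu> = (- 2) *\<^sub>R mat 1"
  \<comment> \<open>Componentwise multiplication is the case of n blocks of size 1, with scaling
    factor 1.\<close>
  proof (rule Mmu_matrix_units[where a = id and b = id and r = id and t = "\<lambda>_. 1" and I = UNIV])
    show "bij_betw (\<lambda>p. (id p, id p)) UNIV {(i, j :: 'n). i \<in> UNIV \<and> j \<in> UNIV \<and> id i = id j}"
      by (auto simp: bij_betw_def inj_on_def)
    show "real (card {j\<in>UNIV. id j = id i}) * 1\<^sup>2 = 1" for i :: 'n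
      by simp
  qed (auto simp: \<nu>_def axis_def)
  then have "Fn \<nu> = 4 / real CARD('n)"
    using nz norm_sq_alg_eq_0_iff[OF bil] by (blast intro: Fn_eq_of_Mmu_scalar)
  then show ?thesis
    using that bil as nz by blast
qed

text \<open>The universal bound is attained, so minimality over all algebras becomes a numerical
  condition on one of them.\<close>

lemma is_min_An_iff:
  fixes \<mu> :: "'n::finite alg"
  assumes "cbilinear \<mu>" "\<mu> \<noteq> (\<lambda>X Y. 0)"
  shows "is_min_An \<mu> \<longleftrightarrow> Fn \<mu> = 4 / real CARD('n)"
proof
  assume "is_min_An \<mu>"
  then have "Fn \<mu> \<le> 4 / real CARD('n)"
    using Fn_attains_bound unfolding is_min_An_def by metis
  moreover have "4 / real CARD('n) \<le> Fn \<mu>"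
    using Fn_ge norm_sq_alg_eq_0_iff assms by blast
  ultimately show "Fn \<mu> = 4 / real CARD('n)" by simp
next
  assume "Fn \<mu> = 4 / real CARD('n)"
  then show "is_min_An \<mu>"
    unfolding is_min_An_def using Fn_ge norm_sq_alg_eq_0_iff by metis
qed

section \<open>Transport along the action of GL(n)\<close>

lemma cbilinear_gl_act:
  assumes "cbilinear \<mu>"
  shows "cbilinear (gl_act g \<mu>)"
proof -
  have lin: "Vector_Spaces.linear (*s) (*s) (\<mu> x)" "Vector_Spaces.linear (*s) (*s) (\<lambda>x. \<mu> x y)" for x y
    using assms by (auto simp: cbilinear_def)
  show ?thesis
    unfolding cbilinear_def Vector_Spaces.linear_iff
    by (intro allI conjI vec.vector_space_axioms)
      (simp_all add: gl_act_def vec.add vec.scale vec.linear_add[OF lin(1)] vec.linear_add[OF lin(2)]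
        vec.linear_scale[OF lin(1)] vec.linear_scale[OF lin(2)])
qed

lemma gl_act_mult:
  assumes "invertible g"
  shows "gl_act g \<mu> (g *v x) (g *v y) = g *v \<mu> x y"
  using matrix_inv_mult[OF assms] by (simp add: gl_act_def matrix_vector_mul_assoc)

text \<open>The action of g is transport of structure. Criticality concerns g.mu, semisimplicity
  concerns mu; this moves the offending ideals from the latter to the former.\<close>

lemma square_zero_ideal_gl_act:
  assumes g: "invertible g" and J: "alg_ideal \<mu> J" "\<forall>x\<in>J. \<forall>y\<in>J. \<mu> x y = 0"
  shows "alg_ideal (gl_act g \<mu>) ((*v) g ` J)"
    and "x \<in> (*v) g ` J \<Longrightarrow> y \<in> (*v) g ` J \<Longrightarrow> gl_act g \<mu> x y = 0"
proof -
  have "vec.subspace J"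
    using J by (auto simp: alg_ideal_def csubspace_def vec.subspace_def)
  then have "vec.subspace ((*v) g ` J)"
    by (rule vec.subspace_image)
  then have "csubspace ((*v) g ` J)"
    by (auto simp: csubspace_def vec.subspace_def)
  moreover have "gl_act g \<mu> (g *v x) y \<in> (*v) g ` J \<and> gl_act g \<mu> y (g *v x) \<in> (*v) g ` J"
    if "x \<in> J" for x y
  proof -
    have y: "y = g *v (matrix_inv g *v y)"
      using matrix_inv_mult[OF g] by (simp add: matrix_vector_mul_assoc)
    have "\<mu> x (matrix_inv g *v y) \<in> J" "\<mu> (matrix_inv g *v y) x \<in> J"
      using that J by (auto simp: alg_ideal_def)
    then show ?thesis
      by (subst (1 2) y) (simp add: gl_act_mult g)
  qed
  ultimately show "alg_ideal (gl_act g \<mu>) ((*v) g ` J)"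
    by (auto simp: alg_ideal_def)
  show "x \<in> (*v) g ` J \<Longrightarrow> y \<in> (*v) g ` J \<Longrightarrow> gl_act g \<mu> x y = 0"
    using J by (auto simp: gl_act_mult g)
qed

theorem theorem4p6:
  fixes \<mu> :: "complex^'n::finite \<Rightarrow> complex^'n \<Rightarrow> complex^'n"
  assumes "cbilinear \<mu>" and "assoc_alg \<mu>" and "\<mu> \<noteq> (\<lambda>X Y. 0)"
  shows "((\<exists>g::complex^'n^'n. invertible g \<and> is_min_An (gl_act g \<mu>)) \<longleftrightarrow> semisimple \<mu>)
    \<and> (\<forall>g::complex^'n^'n. invertible g \<and> is_min_An (gl_act g \<mu>)
          \<longrightarrow> Fn (gl_act g \<mu>) = 4 / real CARD('n))"
proof -
  have inj: "x = 0" if "invertible g" "g *v x = 0" for g :: "complex^'n^'n" and x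
    using matrix_inv_mult(1)[OF that(1)] that(2)
    by (metis matrix_vector_mul_assoc matrix_vector_mul_lid vec.zero)
  have nz: "gl_act g \<mu> \<noteq> (\<lambda>X Y. 0)" if "invertible g" for g
    using assms(3) gl_act_mult[OF that, of \<mu>] inj[OF that] by metis
  have min_iff: "is_min_An (gl_act g \<mu>) \<longleftrightarrow> Fn (gl_act g \<mu>) = 4 / real CARD('n)" if "invertible g" for g
    using is_min_An_iff cbilinear_gl_act nz that assms(1) by blast
  have "semisimple \<mu>" if g: "invertible g" "is_min_An (gl_act g \<mu>)" for g
    unfolding semisimple_iff_no_square_zero_ideal[OF assms(1,2)]
  proof (intro allI impI)
    fix J assume J: "alg_ideal \<mu> J" "\<forall>x\<in>J. \<forall>y\<in>J. \<mu> x y = 0"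
    let ?\<nu> = "gl_act g \<mu>" and ?c = "- 2 * norm_sq_alg (gl_act g \<mu>) / real CARD('n)"
    have bil: "cbilinear ?\<nu>"
      using assms(1) by (rule cbilinear_gl_act)
    have n: "norm_sq_alg ?\<nu> \<noteq> 0"
      using nz[OF g(1)] norm_sq_alg_eq_0_iff[OF bil] by blast
    then have "norm_sq_alg ?\<nu> > 0"
      by (simp add: norm_sq_alg_def sum_nonneg order.not_eq_order_implies_strict)
    then have "?c < 0" by (simp add: field_simps)
    moreover have "Mmu ?\<nu> = ?c *\<^sub>R mat 1"
      using Fn_eq_iff[OF n] min_iff g by blast
    ultimately have "(*v) g ` J \<subseteq> {0}"
      using no_square_zero_ideal[OF bil] square_zero_ideal_gl_act[OF g(1) J] by blast
    then show "J \<subseteq> {0}"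
      using inj[OF g(1)] by blast
  qed
  moreover have "\<exists>g. invertible g \<and> is_min_An (gl_act g \<mu>)" if "semisimple \<mu>"
  proof -
    interpret semisimple_algebra \<mu>
      using assms that by unfold_locales
    obtain g where g: "invertible g" "Mmu (gl_act g \<mu>) = (- 2) *\<^sub>R mat 1"
      by (rule exists_Mmu_scalar)
    then have "Fn (gl_act g \<mu>) = 4 / real CARD('n)"
      using nz[OF g(1)] norm_sq_alg_eq_0_iff[OF cbilinear_gl_act[OF assms(1)]]
      by (blast intro: Fn_eq_of_Mmu_scalar)
    then show ?thesis
      using g(1) min_iff by blast
  qed
  ultimately show ?thesis
    using min_iff by blast
qed

end
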